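(* Let $\mathcal{P}$ be a nice pointclass with the property of Baire. If $X$ is a Peano continuum, $x\in X$, and $G \unlhd \pi_1(X, x)$ is a normal subgroup of pointclass $\mathcal{P}$, then $\pi_1(X, x)/G$ is either finitely generated (in case $G$ is open) or of cardinality $2^{\aleph_0}$ (in case $G$ is not open).
   Context: A Peano continuum is a path connected, locally path connected compact metrizable space. For a path connected metric space $X$ and $x\in X$, $L_x$ is the set of loops $[0,1]\to X$ based at $x$ with the sup metric. For $G\leq \pi_1(X,x)$, $\bigcup G\subseteq L_x$ is the set of all loops whose homotopy class lies in $G$; $G$ is open (resp. of pointclass $\mathcal{P}$) if $\bigcup G$ is open (resp. belongs to $\mathcal{P}$) in $L_x$. A space is Polish if it is completely metrizable and separable; $L_x$ is Polish when $X$ is. A pointclass on Polish spaces assigns to each Polish space a collection of its subsets (of a given topological description). It is nice if it contains the closed sets and is closed under continuous images and preimages (between Polish spaces), countable intersections and finite unions. A subset $Y$ of a space $Z$ has the property of Baire (BP) if there is an open $O\subseteq Z$ with $Y\Delta O$ meager; a pointclass on Polish spaces has BP if each set in it has BP. *)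

theory Defs
  imports "HOL-Analysis.Analysis" "HOL-Algebra.Generated_Groups"
begin

section \<open>Polish spaces and pointclasses\<close>

definition Polish_space :: "'a topology \<Rightarrow> bool" where
  "Polish_space X \<longleftrightarrow> completely_metrizable_space X \<and> separable_space X"

definition nowhere_dense_in :: "'a topology \<Rightarrow> 'a set \<Rightarrow> bool" where
  "nowhere_dense_in X A \<longleftrightarrow> A \<subseteq> topspace X \<and> X interior_of (X closure_of A) = {}"

definition meager_in :: "'a topology \<Rightarrow> 'a set \<Rightarrow> bool" where
  "meager_in X A \<longleftrightarrow> (countable union_of nowhere_dense_in X) A"

definition has_BP_in :: "'a topology \<Rightarrow> 'a set \<Rightarrow> bool" where
  "has_BP_in X A \<longleftrightarrow> A \<subseteq> topspace X \<and> (\<exists>U. openin X U \<and> meager_in X (sym_diff A U))"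

text \<open>
  A pointclass should assign a collection of subsets to every Polish space, of whatever type.
  HOL cannot quantify over all types at once, so the Polish spaces are taken to be those whose
  carrier is a set of real numbers, with an arbitrary Polish topology, unrelated to the usual one.
  By \<open>Polish_space_has_real_copy\<close> below, every Polish space of any type is homeomorphic to one of
  these.  The values of a pointclass at topologies that are not Polish are irrelevant.
\<close>

type_synonym pointclass = "real topology \<Rightarrow> real set set"

definition is_pointclass :: "pointclass \<Rightarrow> bool" where
  "is_pointclass \<P> \<longleftrightarrow> (\<forall>Z. Polish_space Z \<longrightarrow> \<P> Z \<subseteq> Pow (topspace Z))"

definition nice_pointclass :: "pointclass \<Rightarrow> bool" where
  "nice_pointclass \<P> \<longleftrightarrow> is_pointclass \<P> \<and>
     (\<forall>Z A. Polish_space Z \<and> closedin Z A \<longrightarrow> A \<in> \<P> Z) \<and>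
     (\<forall>Y Z f A. Polish_space Y \<and> Polish_space Z \<and> continuous_map Y Z f \<and> A \<in> \<P> Y
        \<longrightarrow> f ` A \<in> \<P> Z) \<and>
     (\<forall>Y Z f B. Polish_space Y \<and> Polish_space Z \<and> continuous_map Y Z f \<and> B \<in> \<P> Z
        \<longrightarrow> {y \<in> topspace Y. f y \<in> B} \<in> \<P> Y) \<and>
     (\<forall>Z (A :: nat \<Rightarrow> real set). Polish_space Z \<and> (\<forall>n. A n \<in> \<P> Z) \<longrightarrow> (\<Inter>n. A n) \<in> \<P> Z) \<and>
     (\<forall>Z A B. Polish_space Z \<and> A \<in> \<P> Z \<and> B \<in> \<P> Z \<longrightarrow> A \<union> B \<in> \<P> Z)"

definition pointclass_has_BP :: "pointclass \<Rightarrow> bool" where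
  "pointclass_has_BP \<P> \<longleftrightarrow> (\<forall>Z. Polish_space Z \<longrightarrow> (\<forall>A \<in> \<P> Z. has_BP_in Z A))"

text \<open>
  Membership in a pointclass for a subset of a Polish space of arbitrary type: it is read off on a
  homeomorphic copy with real carrier.  For a nice pointclass the choice of the copy does not
  matter, see \<open>in_pointclass_iff\<close>.
\<close>

definition in_pointclass :: "pointclass \<Rightarrow> 'a topology \<Rightarrow> 'a set \<Rightarrow> bool" where
  "in_pointclass \<P> X A \<longleftrightarrow> A \<subseteq> topspace X \<and>
     (\<exists>Z h. Polish_space Z \<and> homeomorphic_map X Z h \<and> h ` A \<in> \<P> Z)"

lemma Polish_space_homeomorphic:
  assumes "X homeomorphic_space Y" "Polish_space X"
  shows "Polish_space Y"
  using assms homeomorphic_completely_metrizable_space homeomorphic_separable_space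
  unfolding Polish_space_def by blast

lemma Polish_space_has_real_copy:
  fixes X :: "'a topology"
  assumes "Polish_space X"
  obtains Z :: "real topology" and h where "Polish_space Z" "homeomorphic_map X Z h"
proof -
  obtain M d where Md: "Metric_space M d" and X: "X = Metric_space.mtopology M d"
    using assms unfolding Polish_space_def completely_metrizable_space_def by blast
  interpret Metric_space M d by (rule Md)
  obtain C where C: "countable C" "C \<subseteq> M" "X closure_of C = M"
    using assms X unfolding Polish_space_def separable_space_def by auto
  define e :: "'a \<Rightarrow> (nat \<times> nat) set"
    where "e = (\<lambda>x. {(i, n). from_nat_into C i \<in> C \<and> d x (from_nat_into C i) < inverse (Suc n)})"
  have "inj_on e M"
  proof (rule inj_onI, rule ccontr)
    fix x y assume xy: "x \<in> M" "y \<in> M" "e x = e y" "x \<noteq> y"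
    then have "d x y / 2 > 0" by simp
    then obtain n where n: "inverse (real (Suc n)) < d x y / 2"
      using reals_Archimedean by blast
    have "x \<in> X closure_of C" using xy C by simp
    then obtain c where c: "c \<in> C" "d x c < inverse (Suc n)"
      unfolding X metric_closure_of
      by (auto simp: in_mball dest: spec[of _ "inverse (Suc n)"])
    define i where "i = to_nat_on C c"
    have i: "from_nat_into C i = c" using c C i_def by simp
    have "(i, n) \<in> e x" using c i by (simp add: e_def)
    then have "(i, n) \<in> e y" using xy by simp
    then have "d y c < inverse (Suc n)" using i by (simp add: e_def)
    then have "d x y < d x y"
      using n c triangle[of x c y] commute[of y c] xy C by (smt (verit) field_sum_of_halves subsetD)
    then show False by simp
  qed
  moreover obtain g :: "(nat \<times> nat) set \<Rightarrow> real" where "inj g"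
  proof -
    have "inj ((`) prod_encode)"
      by (simp add: inj_image_eq_iff inj_def inj_prod_encode)
    moreover obtain k :: "nat set \<Rightarrow> real" where "inj k"
      using nat_sets_eqpoll_reals unfolding eqpoll_def bij_betw_def by blast
    ultimately show thesis using that inj_compose by blast
  qed
  ultimately have "inj_on (g \<circ> e) M"
    using comp_inj_on inj_on_subset by blast
  then obtain h :: "'a \<Rightarrow> real" where h: "inj_on h (topspace X)"
    using X by auto
  define Z where "Z = pullback_topology (h ` topspace X) (inv_into (topspace X) h) X"
  have topZ: "topspace Z = h ` topspace X"
    using h by (auto simp: Z_def topspace_pullback_topology)
  have "homeomorphic_maps X Z h (inv_into (topspace X) h)"
    unfolding homeomorphic_maps_def
  proof (intro conjI)
    show "continuous_map Z X (inv_into (topspace X) h)"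
      unfolding Z_def using continuous_map_pullback[OF continuous_map_id[of X]]
      by (simp add: comp_def id_def)
    have "continuous_map X X (inv_into (topspace X) h \<circ> h)"
      by (rule continuous_map_eq[OF continuous_map_id]) (use h in simp)
    then show "continuous_map X Z h"
      unfolding Z_def by (intro continuous_map_pullback') auto
  qed (use h topZ in auto)
  then have "homeomorphic_map X Z h"
    using homeomorphic_map_maps by blast
  then show thesis
    using that Polish_space_homeomorphic[OF _ assms] homeomorphic_map_imp_homeomorphic_space by blast
qed

lemma in_pointclass_iff:
  assumes "nice_pointclass \<P>" "Polish_space Z" "homeomorphic_map X Z h" "A \<subseteq> topspace X"
  shows "in_pointclass \<P> X A \<longleftrightarrow> h ` A \<in> \<P> Z"
proof
  assume "in_pointclass \<P> X A"
  then obtain Z' h' where Z': "Polish_space Z'" "homeomorphic_map X Z' h'" "h' ` A \<in> \<P> Z'"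
    unfolding in_pointclass_def by blast
  obtain k where k: "homeomorphic_maps X Z' h' k"
    using Z'(2) homeomorphic_map_maps by blast
  have "continuous_map Z' Z (h \<circ> k)"
    using k assms(3) continuous_map_compose homeomorphic_imp_continuous_map
    unfolding homeomorphic_maps_def by blast
  then have "(h \<circ> k) ` (h' ` A) \<in> \<P> Z"
    using assms(1,2) Z' unfolding nice_pointclass_def by blast
  moreover have "(h \<circ> k) ` (h' ` A) = h ` A"
    using k assms(4) unfolding homeomorphic_maps_def by (force simp: image_iff)
  ultimately show "h ` A \<in> \<P> Z" by simp
qed (use assms in \<open>auto simp: in_pointclass_def\<close>)


section \<open>Loops and the fundamental group\<close>

text \<open>
  The ambient type is a metric space, so metrizability is automatic, and \<^term>\<open>X\<close> carries the
  metric that is used for the space of loops.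
\<close>

definition Peano_continuum :: "'a::metric_space set \<Rightarrow> bool" where
  "Peano_continuum X \<longleftrightarrow> path_connected X \<and> locally path_connected X \<and> compact X"

text \<open>
  Paths are functions on all of \<open>\<real>\<close>; restricting to extensional ones makes loops
  correspond to functions on \<open>[0,1]\<close>.
\<close>

definition loops :: "'a::metric_space set \<Rightarrow> 'a \<Rightarrow> (real \<Rightarrow> 'a) set" where
  "loops X x = {p \<in> extensional {0..1}. path p \<and> path_image p \<subseteq> X \<and>
                  pathstart p = x \<and> pathfinish p = x}"

definition loop_space :: "'a::metric_space set \<Rightarrow> 'a \<Rightarrow> (real \<Rightarrow> 'a) metric" where
  "loop_space X x = submetric (cfunspace (top_of_set {0..1}) euclidean_metric) (loops X x)"

lemma mspace_loop_space [simp]: "mspace (loop_space X x) = loops X x"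
proof -
  have "Metric_space.mbounded UNIV dist (p ` {0..1})" if "path p" for p :: "real \<Rightarrow> 'a"
  proof -
    have "compact (p ` {0..1})"
      using that compact_path_image by (auto simp: path_image_def)
    then show ?thesis
      using compact_imp_bounded by auto
  qed
  then show ?thesis
    by (auto simp: loop_space_def loops_def path_def)
qed

lemma mdist_loop_space:
  assumes "p \<in> loops X x" "q \<in> loops X x"
  shows "mdist (loop_space X x) p q = (SUP t\<in>{0..1}. dist (p t) (q t))"
proof -
  have "p \<in> mspace (loop_space X x)" "q \<in> mspace (loop_space X x)"
    using assms by auto
  then have "p \<in> Metric_space.fspace UNIV dist {0..1}" "q \<in> Metric_space.fspace UNIV dist {0..1}"
    by (auto simp: loop_space_def cfunspace_def)
  then show ?thesis
    by (simp add: loop_space_def cfunspace_def Metric_space.fdist_def[OF Met_TC.Metric_space_axioms])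
qed

text \<open>
  A class consists of extensional loops, but \<^term>\<open>p\<close> itself need not be extensional
  (a concatenation of two extensional loops is not).
\<close>

definition loop_class :: "'a::metric_space set \<Rightarrow> 'a \<Rightarrow> (real \<Rightarrow> 'a) \<Rightarrow> (real \<Rightarrow> 'a) set" where
  "loop_class X x p = {q \<in> loops X x. homotopic_paths X p q}"

definition fundamental_group ::
    "'a::metric_space set \<Rightarrow> 'a \<Rightarrow> (real \<Rightarrow> 'a) set monoid" where
  "fundamental_group X x =
     \<lparr>carrier = loop_class X x ` loops X x,
      mult = (\<lambda>a b. \<Union>p\<in>a. \<Union>q\<in>b. loop_class X x (p +++ q)),
      one = loop_class X x (\<lambda>_. x)\<rparr>"

lemma group_fundamental_group:
  assumes "x \<in> X"
  shows "group (fundamental_group X x)"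
proof -
  let ?c = "\<lambda>_::real. x"
  have c: "path ?c" "path_image ?c \<subseteq> X" "pathstart ?c = x" "pathfinish ?c = x"
    using assms by (auto simp: path_def path_image_def pathstart_def pathfinish_def)
  define isl where "isl p \<longleftrightarrow> path p \<and> path_image p \<subseteq> X \<and> pathstart p = x \<and> pathfinish p = x" for p
  have isl_c: "isl ?c" using c by (simp add: isl_def)
  have isl_join: "isl (p +++ q)" if "isl p" "isl q" for p q
    using that by (auto simp: isl_def path_image_join)
  have isl_rev: "isl (reversepath p)" if "isl p" for p
    using that by (auto simp: isl_def)
  have loops_isl: "isl p" if "p \<in> loops X x" for p
    using that by (simp add: isl_def loops_def)
  have refl: "homotopic_paths X p p" if "isl p" for p
    using that by (simp add: isl_def)
  have class_eq: "loop_class X x p = loop_class X x q" if "homotopic_paths X p q" for p q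
    using that homotopic_paths_sym homotopic_paths_trans unfolding loop_class_def by blast
  have restr: "\<exists>p' \<in> loops X x. homotopic_paths X p p'" if "isl p" for p
  proof (rule bexI)
    show *: "homotopic_paths X p (restrict p {0..1})"
      using that by (intro homotopic_paths_eq) (auto simp: isl_def)
    show "restrict p {0..1} \<in> loops X x"
      using that homotopic_paths_imp_path[OF *] homotopic_paths_imp_subset[OF *]
      by (auto simp: loops_def isl_def pathstart_def pathfinish_def)
  qed
  have carr: "loop_class X x p \<in> carrier (fundamental_group X x)" if "isl p" for p
    using restr[OF that] class_eq by (auto simp: fundamental_group_def)
  have carrE: "\<exists>p. isl p \<and> a = loop_class X x p" if "a \<in> carrier (fundamental_group X x)" for a
    using that loops_isl by (auto simp: fundamental_group_def)
  have mult: "loop_class X x p \<otimes>\<^bsub>fundamental_group X x\<^esub> loop_class X x q = loop_class X x (p +++ q)"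
    if "isl p" "isl q" for p q
  proof -
    have "loop_class X x (p' +++ q') = loop_class X x (p +++ q)"
      if "p' \<in> loop_class X x p" "q' \<in> loop_class X x q" for p' q'
      using that \<open>isl p\<close> \<open>isl q\<close>
      by (intro class_eq homotopic_paths_sym[OF homotopic_paths_join])
         (auto simp: loop_class_def isl_def)
    moreover have "loop_class X x p \<noteq> {}" "loop_class X x q \<noteq> {}"
      using restr that by (auto simp: loop_class_def)
    ultimately show ?thesis
      by (auto simp: fundamental_group_def)
  qed
  have one: "\<one>\<^bsub>fundamental_group X x\<^esub> = loop_class X x ?c"
    by (simp add: fundamental_group_def)
  have lid: "homotopic_paths X (?c +++ p) p" if "isl p" for p
  proof (rule homotopic_paths_sym[OF homotopic_paths_reparametrize])
    show "continuous_on {0..1} (\<lambda>t::real. max 0 (2 * t - 1))"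
      by (intro continuous_intros)
    show "(?c +++ p) t = p (max 0 (2 * t - 1))" if "t \<in> {0..1}" for t
      using that \<open>isl p\<close>
      by (cases "t \<le> 1/2") (auto simp: isl_def joinpaths_def pathstart_def max_absorb1 max_absorb2)
  qed (use that in \<open>auto simp: isl_def\<close>)
  have linv: "homotopic_paths X (reversepath p +++ p) ?c" if "isl p" for p
  proof (rule homotopic_paths_sym)
    let ?h = "\<lambda>(s::real, t::real). p (1 - s * min (2 * t) (2 - 2 * t))"
    have p: "continuous_on {0..1} p" "p ` {0..1} \<subseteq> X" "p 0 = x" "p 1 = x"
      using that by (auto simp: isl_def path_def path_image_def pathstart_def pathfinish_def)
    have in01: "1 - s * min (2 * t) (2 - 2 * t) \<in> {0..1}" if "s \<in> {0..1}" "t \<in> {0..1}" for s t :: real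
    proof -
      have "0 \<le> min (2 * t) (2 - 2 * t)" "min (2 * t) (2 - 2 * t) \<le> 1"
        using that by (auto simp: min_def)
      then show ?thesis
        using that mult_le_one[of s "min (2 * t) (2 - 2 * t)"] by simp
    qed
    have "continuous_on ({0..1} \<times> {0..1})
        (\<lambda>z. p (1 - fst z * min (2 * snd z) (2 - 2 * snd z)))"
    proof (rule continuous_on_compose2[OF p(1)])
      show "continuous_on ({0..1} \<times> {0..1})
          (\<lambda>z::real \<times> real. 1 - fst z * min (2 * snd z) (2 - 2 * snd z))"
        by (intro continuous_intros)
      show "(\<lambda>z::real \<times> real. 1 - fst z * min (2 * snd z) (2 - 2 * snd z)) ` ({0..1} \<times> {0..1}) \<subseteq> {0..1}"
        by (intro image_subsetI in01) auto
    qed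
    then have "continuous_on ({0..1} \<times> {0..1}) ?h"
      by (simp add: case_prod_unfold)
    moreover have "?h \<in> {0..1} \<times> {0..1} \<rightarrow> X"
      using in01 p(2) by (simp add: Pi_iff image_subset_iff)
    moreover have "?h (1, t) = (reversepath p +++ p) t" for t
      by (cases "t \<le> 1/2") (simp_all add: joinpaths_def reversepath_def min_absorb1 min_absorb2)
    ultimately show "homotopic_paths X ?c (reversepath p +++ p)"
      unfolding homotopic_paths
      by (intro exI[of _ ?h]) (simp add: p pathstart_def pathfinish_def)
  qed
  show ?thesis
  proof (rule groupI)
    fix a b d
    assume "a \<in> carrier (fundamental_group X x)" "b \<in> carrier (fundamental_group X x)"
      "d \<in> carrier (fundamental_group X x)"
    then obtain p q r where pqr: "isl p" "isl q" "isl r"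
      "a = loop_class X x p" "b = loop_class X x q" "d = loop_class X x r"
      using carrE by metis
    show "a \<otimes>\<^bsub>fundamental_group X x\<^esub> b \<otimes>\<^bsub>fundamental_group X x\<^esub> d
        = a \<otimes>\<^bsub>fundamental_group X x\<^esub> (b \<otimes>\<^bsub>fundamental_group X x\<^esub> d)"
      using pqr by (simp add: mult isl_join)
        (intro class_eq homotopic_paths_sym[OF homotopic_paths_assoc]; simp add: isl_def)
    show "a \<otimes>\<^bsub>fundamental_group X x\<^esub> b \<in> carrier (fundamental_group X x)"
      using pqr by (simp add: mult isl_join carr)
    show "\<one>\<^bsub>fundamental_group X x\<^esub> \<otimes>\<^bsub>fundamental_group X x\<^esub> a = a"
      using pqr isl_c by (simp add: one mult class_eq[OF lid])
    show "\<exists>b \<in> carrier (fundamental_group X x).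
        b \<otimes>\<^bsub>fundamental_group X x\<^esub> a = \<one>\<^bsub>fundamental_group X x\<^esub>"
      using pqr by (intro bexI[of _ "loop_class X x (reversepath p)"])
        (simp_all add: one mult isl_rev carr class_eq[OF linv])
  qed (simp add: one carr isl_c)
qed

definition finitely_generated_group :: "('a, 'b) monoid_scheme \<Rightarrow> bool" where
  "finitely_generated_group G \<longleftrightarrow>
     (\<exists>A. finite A \<and> A \<subseteq> carrier G \<and> generate G A = carrier G)"

end

theory Submission
  imports Defs
begin

text \<open>
  Joining a fixed base point to every point of \<^term>\<open>X\<close> turns the projection onto the quotient
  into a multiplicative, homotopy invariant map on all paths of \<^term>\<open>X\<close>.  The dichotomy is
  whether this map kills all sufficiently small loops.

  If it does, then uniformly so by compactness; paths that stay close together have the same image,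
  so \<open>\<Union>G\<close> is open, and after conjugation with short paths to a finite net only finitely many
  images of short paths remain, which generate the quotient.

  If it does not, there are loops \<open>\<beta> 0, \<beta> 1, \<dots>\<close> at some point that shrink to the point and are
  not killed.  For a binary sequence \<open>a\<close>, concatenate those \<open>\<beta> n\<close> with \<open>a n\<close> true.  Having
  the same image in the quotient is an equivalence relation on binary sequences with the Baire
  property, and changing a single bit changes the class.  The latter forces the relation to be
  meager, and Mycielski's theorem then gives continuum many classes.
\<close>

section \<open>Paths and loop classes\<close>

text \<open>The image of an infinite concatenation is not determined by the images of its loops, and
  nothing is known about relations among the latter. What survives is cancellation: finitely many
  loops can be split off in front, and sequences that agree from some point on have the same
  remaining path. So if two sequences that differ in exactly one bit had the same image, cancelling
  on both sides would kill the loop at that bit.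

  For the category step, a nonmeager relation with the Baire property would be comeager in some
  cylinder of pairs. Flipping a bit of the second sequence beyond the fixed prefix is a
  homeomorphism that maps this cylinder to itself, so some pair and its flip would both be related,
  and hence two sequences that differ in one bit.

  The Baire property of \<open>\<Union>G\<close> alone would not give that of the relation, since it
  can be lost under continuous preimages. The pointclass, however, is closed under them, and the
  relation is the preimage of \<open>\<Union>G\<close> under a continuous map that turns a pair of
  sequences into a loop at \<open>x\<close>. At most continuum many cosets exist because the loop
  space has a copy with real carrier.\<close>

definition path_in :: "'a::metric_space set \<Rightarrow> (real \<Rightarrow> 'a) \<Rightarrow> bool" where
  "path_in X p \<longleftrightarrow> path p \<and> path_image p \<subseteq> X"

lemma path_in_const: "y \<in> X \<Longrightarrow> path_in X (\<lambda>_. y)"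
  by (auto simp: path_in_def path_def path_image_def)

lemma pathstart_const [simp]: "pathstart (\<lambda>_. y) = y"
  and pathfinish_const [simp]: "pathfinish (\<lambda>_. y) = y"
  by (auto simp: pathstart_def pathfinish_def)

lemma path_in_join [simp]:
  "pathfinish p = pathstart q \<Longrightarrow> path_in X (p +++ q) \<longleftrightarrow> path_in X p \<and> path_in X q"
  by (auto simp: path_in_def path_image_join)

lemma path_in_reversepath [simp]: "path_in X (reversepath p) \<longleftrightarrow> path_in X p"
  by (auto simp: path_in_def)

text \<open>The library's \<^const>\<open>subpath\<close> is only available in normed vector spaces.\<close>

definition segment_of :: "real \<Rightarrow> real \<Rightarrow> (real \<Rightarrow> 'a) \<Rightarrow> real \<Rightarrow> 'a" where
  "segment_of u v p = p \<circ> subpath u v id"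

lemma segment_of_apply: "segment_of u v p t = p ((v - u) * t + u)"
  by (simp add: segment_of_def subpath_def)

lemma pathstart_segment_of [simp]: "pathstart (segment_of u v p) = p u"
  and pathfinish_segment_of [simp]: "pathfinish (segment_of u v p) = p v"
  by (auto simp: segment_of_apply pathstart_def pathfinish_def)

lemma segment_of_arg:
  fixes t :: real
  assumes "0 \<le> u" "u \<le> v" "v \<le> 1" "t \<in> {0..1}"
  shows "(v - u) * t + u \<in> {u..v}" "(v - u) * t + u \<in> {0..1}"
proof -
  have "(v - u) * t \<le> v - u" "0 \<le> (v - u) * t"
    using assms mult_left_le[of t "v - u"] by auto
  then show "(v - u) * t + u \<in> {u..v}" "(v - u) * t + u \<in> {0..1}" using assms by auto
qed

lemma path_in_segment_of:
  assumes "path_in X p" "0 \<le> u" "u \<le> v" "v \<le> 1"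
  shows "path_in X (segment_of u v p)"
proof -
  have "continuous_on {0..1} p"
    using assms by (simp add: path_in_def path_def)
  then have "continuous_on {0..1} (\<lambda>t. p ((v - u) * t + u))"
    by (rule continuous_on_compose2)
      (use segment_of_arg(2)[OF assms(2-4)] in \<open>auto intro!: continuous_intros\<close>)
  then have "continuous_on {0..1} (segment_of u v p)"
    by (simp add: segment_of_apply[abs_def])
  then show ?thesis
    using assms segment_of_arg(2)[OF assms(2-4)]
    by (auto simp: path_in_def path_def path_image_def segment_of_apply image_subset_iff)
qed

text \<open>The homotopy is found inside the unit interval, between subpaths of the identity, and
  then pushed forward along \<open>p\<close>.\<close>

lemma homotopic_paths_join_segments:
  assumes "path_in X p" "0 \<le> u" "u \<le> v" "v \<le> w" "w \<le> 1"
  shows "homotopic_paths X (segment_of u v p +++ segment_of v w p) (segment_of u w p)"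
proof -
  have "homotopic_paths {0..1} (subpath u v id +++ subpath v w id) (subpath u w (id::real \<Rightarrow> real))"
    using assms by (intro homotopic_join_subpaths) (auto simp: path_def path_image_def)
  then have "homotopic_paths X (p \<circ> (subpath u v id +++ subpath v w id)) (p \<circ> subpath u w id)"
    using assms by (intro homotopic_paths_continuous_image)
      (auto simp: path_in_def path_def path_image_def)
  then show ?thesis by (simp add: path_compose_join segment_of_def)
qed

lemma path_in_endpoints:
  assumes "path_in X p" shows "pathstart p \<in> X" "pathfinish p \<in> X"
  using assms unfolding path_in_def by auto

lemma path_in_mono: "path_in X p \<Longrightarrow> X \<subseteq> Y \<Longrightarrow> path_in Y p"
  by (auto simp: path_in_def)

lemma path_in_apply: "path_in X p \<Longrightarrow> t \<in> {0..1} \<Longrightarrow> p t \<in> X"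
  by (auto simp: path_in_def path_image_def)

lemma homotopic_paths_const_join:
  assumes "path_in X p"
  shows "homotopic_paths X ((\<lambda>_. pathstart p) +++ p) p"
proof (rule homotopic_paths_sym[OF homotopic_paths_reparametrize])
  \<comment> \<open>The join is \<open>p\<close> reparametrized: it waits at parameter 0 for the
    first half and then runs at double speed.\<close>
  show "continuous_on {0..1} (\<lambda>t::real. max 0 (2 * t - 1))"
    by (intro continuous_intros)
  show "((\<lambda>_. pathstart p) +++ p) t = p (max 0 (2 * t - 1))" if "t \<in> {0..1}" for t
    using that
    by (cases "t \<le> 1/2") (auto simp: joinpaths_def pathstart_def max_absorb1 max_absorb2)
qed (use assms in \<open>auto simp: path_in_def\<close>)

lemma homotopic_paths_join_const:
  assumes "path_in X p"
  shows "homotopic_paths X (p +++ (\<lambda>_. pathfinish p)) p"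
proof (rule homotopic_paths_sym[OF homotopic_paths_reparametrize])
  show "continuous_on {0..1} (\<lambda>t::real. min 1 (2 * t))"
    by (intro continuous_intros)
  show "(p +++ (\<lambda>_. pathfinish p)) t = p (min 1 (2 * t))" if "t \<in> {0..1}" for t
    using that
    by (cases "t \<le> 1/2") (auto simp: joinpaths_def pathfinish_def min_absorb1 min_absorb2)
qed (use assms in \<open>auto simp: path_in_def\<close>)

lemma homotopic_paths_reversepath_join:
  assumes "path_in X p"
  shows "homotopic_paths X (reversepath p +++ p) (\<lambda>_. pathfinish p)"
proof (rule homotopic_paths_sym)
  \<comment> \<open>Stage \<open>s\<close> walks back along \<open>p\<close> from its end to
    parameter \<open>1 - s\<close> and returns; the minimum is the tent function with peak 1 at
    \<open>t = 1/2\<close>.\<close>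
  let ?h = "\<lambda>(s::real, t::real). p (1 - s * min (2 * t) (2 - 2 * t))"
  have p: "continuous_on {0..1} p" "p ` {0..1} \<subseteq> X"
    using assms by (auto simp: path_in_def path_def path_image_def)
  have in01: "1 - s * min (2 * t) (2 - 2 * t) \<in> {0..1}" if "s \<in> {0..1}" "t \<in> {0..1}" for s t :: real
  proof -
    have "0 \<le> min (2 * t) (2 - 2 * t)" "min (2 * t) (2 - 2 * t) \<le> 1"
      using that by (auto simp: min_def)
    then show ?thesis
      using that mult_le_one[of s "min (2 * t) (2 - 2 * t)"] by simp
  qed
  have "continuous_on ({0..1} \<times> {0..1}) (\<lambda>z. p (1 - fst z * min (2 * snd z) (2 - 2 * snd z)))"
  proof (rule continuous_on_compose2[OF p(1)])
    show "continuous_on ({0..1} \<times> {0..1})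
        (\<lambda>z::real \<times> real. 1 - fst z * min (2 * snd z) (2 - 2 * snd z))"
      by (intro continuous_intros)
    show "(\<lambda>z::real \<times> real. 1 - fst z * min (2 * snd z) (2 - 2 * snd z)) ` ({0..1} \<times> {0..1}) \<subseteq> {0..1}"
      by (intro image_subsetI in01) auto
  qed
  then have "continuous_on ({0..1} \<times> {0..1}) ?h"
    by (simp add: case_prod_unfold)
  moreover have "?h \<in> {0..1} \<times> {0..1} \<rightarrow> X"
    using in01 p(2) by (simp add: Pi_iff image_subset_iff)
  moreover have "?h (1, t) = (reversepath p +++ p) t" for t
    by (cases "t \<le> 1/2") (simp_all add: joinpaths_def reversepath_def min_absorb1 min_absorb2)
  ultimately show "homotopic_paths X (\<lambda>_. pathfinish p) (reversepath p +++ p)"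
    unfolding homotopic_paths
    by (intro exI[of _ ?h]) (simp add: p pathstart_def pathfinish_def)
qed

lemma homotopic_paths_assoc':
  assumes "path_in X p" "path_in X q" "path_in X r"
    "pathfinish p = pathstart q" "pathfinish q = pathstart r"
  shows "homotopic_paths X ((p +++ q) +++ r) (p +++ (q +++ r))"
  using assms by (intro homotopic_paths_sym[OF homotopic_paths_assoc]) (auto simp: path_in_def)

lemma homotopic_paths_join_path_in:
  assumes "homotopic_paths X p p'" "path_in X q" "pathfinish p = pathstart q"
  shows "homotopic_paths X (p +++ q) (p' +++ q)"
  using assms by (intro homotopic_paths_join) (auto simp: path_in_def)

lemma homotopic_paths_path_in_join:
  assumes "homotopic_paths X q q'" "path_in X p" "pathfinish p = pathstart q"
  shows "homotopic_paths X (p +++ q) (p +++ q')"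
  using assms by (intro homotopic_paths_join) (auto simp: path_in_def)

text \<open>This removes an auxiliary path inserted at a junction; \<open>hol_join\<close> uses it
  for the tail to the common endpoint.\<close>

lemma homotopic_paths_cancel:
  assumes "path_in X p" "path_in X q" "path_in X a"
    "pathfinish p = pathfinish a" "pathstart q = pathfinish a"
  shows "homotopic_paths X ((p +++ reversepath a) +++ (a +++ q)) (p +++ q)"
proof -
  note [trans] = homotopic_paths_trans
  have "homotopic_paths X ((p +++ reversepath a) +++ (a +++ q)) (p +++ (reversepath a +++ (a +++ q)))"
    using assms by (intro homotopic_paths_assoc') auto
  also have "homotopic_paths X \<dots> (p +++ ((reversepath a +++ a) +++ q))"
    using assms by (intro homotopic_paths_path_in_join homotopic_paths_sym[OF homotopic_paths_assoc']) auto
  also have "homotopic_paths X \<dots> (p +++ ((\<lambda>_. pathstart q) +++ q))"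
    using assms homotopic_paths_reversepath_join[of X a]
    by (intro homotopic_paths_path_in_join homotopic_paths_join_path_in) auto
  also have "homotopic_paths X \<dots> (p +++ q)"
    using assms by (intro homotopic_paths_path_in_join homotopic_paths_const_join) auto
  finally show ?thesis .
qed

section \<open>Loop classes and the group operation\<close>

lemma loop_class_cong: "homotopic_paths X p q \<Longrightarrow> loop_class X x p = loop_class X x q"
  using homotopic_paths_sym homotopic_paths_trans unfolding loop_class_def by blast

lemma restrict_in_loops:
  assumes "path_in X p" "pathstart p = x" "pathfinish p = x"
  shows "restrict p {0..1} \<in> loops X x" "homotopic_paths X p (restrict p {0..1})"
proof -
  show *: "homotopic_paths X p (restrict p {0..1})"
    using assms by (intro homotopic_paths_eq) (auto simp: path_in_def)
  show "restrict p {0..1} \<in> loops X x"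
    using assms homotopic_paths_imp_path[OF *] homotopic_paths_imp_subset[OF *]
    by (auto simp: loops_def pathstart_def pathfinish_def)
qed

lemma loopsD:
  assumes "p \<in> loops X x"
  shows "path_in X p" "pathstart p = x" "pathfinish p = x" "p \<in> extensional {0..1}"
  using assms by (auto simp: loops_def path_in_def)

lemma loop_class_in_carrier:
  assumes "path_in X p" "pathstart p = x" "pathfinish p = x"
  shows "loop_class X x p \<in> carrier (fundamental_group X x)"
  using restrict_in_loops(1)[OF assms] loop_class_cong[OF restrict_in_loops(2)[OF assms]]
  by (simp add: fundamental_group_def)

text \<open>The product is a union over representatives. All sets in this union coincide, and as
  both classes are nonempty, the union is their common value.\<close>

lemma loop_class_mult:
  assumes "path_in X p" "pathstart p = x" "pathfinish p = x"
    and "path_in X q" "pathstart q = x" "pathfinish q = x"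
  shows "loop_class X x p \<otimes>\<^bsub>fundamental_group X x\<^esub> loop_class X x q = loop_class X x (p +++ q)"
proof -
  have "loop_class X x (p' +++ q') = loop_class X x (p +++ q)"
    if "p' \<in> loop_class X x p" "q' \<in> loop_class X x q" for p' q'
    using that assms
    by (intro loop_class_cong homotopic_paths_sym[OF homotopic_paths_join]) (auto simp: loop_class_def)
  moreover have "loop_class X x p \<noteq> {}" "loop_class X x q \<noteq> {}"
    using restrict_in_loops[OF assms(1-3)] restrict_in_loops[OF assms(4-6)]
    by (auto simp: loop_class_def)
  ultimately show ?thesis
    by (auto simp: fundamental_group_def)
qed

text \<open>Take a Lebesgue number of the cover by open sets whose traces on \<open>X\<close> are
  path connected and lie in a ball of radius \<open>e/2\<close>. That ball may have any centre;
  moving the centre to \<open>a\<close> costs the factor 2.\<close>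

lemma Peano_continuum_uniformly_lpc:
  fixes X :: "'a::metric_space set"
  assumes "Peano_continuum X" "0 < e"
  obtains d where "0 < d"
    "\<And>a b. \<lbrakk>a \<in> X; b \<in> X; dist a b < d\<rbrakk> \<Longrightarrow>
       \<exists>g. path_in (X \<inter> ball a e) g \<and> pathstart g = a \<and> pathfinish g = b"
proof -
  define \<G> where "\<G> = {O'. open O' \<and> path_connected (X \<inter> O') \<and> (\<exists>a. X \<inter> O' \<subseteq> ball a (e/2))}"
  have "X \<subseteq> \<Union>\<G>"
  proof
    fix a assume a: "a \<in> X"
    have "openin (top_of_set X) (X \<inter> ball a (e/2))" "a \<in> X \<inter> ball a (e/2)"
      using a assms by (auto simp: openin_open_Int)
    then obtain u where u: "openin (top_of_set X) u" "path_connected u" "a \<in> u" "u \<subseteq> X \<inter> ball a (e/2)"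
      using assms(1) unfolding Peano_continuum_def locally_path_connected by metis
    then obtain O' where "open O'" "u = X \<inter> O'"
      unfolding openin_open by blast
    with u show "a \<in> \<Union>\<G>"
      by (auto simp: \<G>_def)
  qed
  moreover have "compact X" using assms by (simp add: Peano_continuum_def)
  moreover have "open O'" if "O' \<in> \<G>" for O' using that by (simp add: \<G>_def)
  ultimately obtain d where d: "0 < d" "\<And>a. a \<in> X \<Longrightarrow> \<exists>O' \<in> \<G>. ball a d \<subseteq> O'"
    using Heine_Borel_lemma[of X \<G>] by metis
  show thesis
  proof (rule that[OF d(1)])
    fix a b assume ab: "a \<in> X" "b \<in> X" "dist a b < d"
    then obtain O' where O': "O' \<in> \<G>" "ball a d \<subseteq> O'" using d by blast
    then have "a \<in> X \<inter> O'" "b \<in> X \<inter> O'" using ab d by auto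
    then obtain g where g: "path g" "path_image g \<subseteq> X \<inter> O'" "pathstart g = a" "pathfinish g = b"
      using O'(1) unfolding \<G>_def path_connected_def by blast
    obtain c where c: "X \<inter> O' \<subseteq> ball c (e/2)" using O'(1) unfolding \<G>_def by blast
    have "X \<inter> O' \<subseteq> ball a e"
    proof
      fix z assume "z \<in> X \<inter> O'"
      then have "dist c z < e/2" "dist c a < e/2" using c \<open>a \<in> X \<inter> O'\<close> by auto
      then show "z \<in> ball a e" by (smt (verit) dist_commute dist_triangle mem_ball field_sum_of_halves)
    qed
    then show "\<exists>g. path_in (X \<inter> ball a e) g \<and> pathstart g = a \<and> pathfinish g = b"
      using g by (auto simp: path_in_def)
  qed
qed

section \<open>The quotient as an invariant of paths\<close>

locale Peano_quotient = normal G "fundamental_group X x"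
  for X :: "'a::metric_space set" and x :: 'a and G +
  assumes Peano: "Peano_continuum X" and base: "x \<in> X"
begin

abbreviation Q where "Q \<equiv> fundamental_group X x Mod G"

sublocale Q: group Q
  by (rule factorgroup_is_group)

definition coset_of :: "(real \<Rightarrow> 'a) \<Rightarrow> (real \<Rightarrow> 'a) set set" where
  "coset_of p = G #>\<^bsub>fundamental_group X x\<^esub> loop_class X x p"

text \<open>At the base point the tail is constant, so that on loops at \<open>x\<close> the map
  \<open>hol\<close> is the projection to the quotient itself.\<close>

definition tail :: "'a \<Rightarrow> real \<Rightarrow> 'a" where
  "tail y = (if y = x then (\<lambda>_. x)
     else SOME g. path_in X g \<and> pathstart g = x \<and> pathfinish g = y)"

text \<open>A groupoid homomorphism from the paths in \<^term>\<open>X\<close> to the quotient.\<close>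

definition hol :: "(real \<Rightarrow> 'a) \<Rightarrow> (real \<Rightarrow> 'a) set set" where
  "hol p = coset_of ((tail (pathstart p) +++ p) +++ reversepath (tail (pathfinish p)))"

lemma tail:
  assumes "y \<in> X"
  shows "path_in X (tail y)" "pathstart (tail y) = x" "pathfinish (tail y) = y"
proof -
  have "path_in X (tail y) \<and> pathstart (tail y) = x \<and> pathfinish (tail y) = y"
  proof (cases "y = x")
    case True
    then show ?thesis using base path_in_const by (simp add: tail_def)
  next
    case False
    have "\<exists>g. path_in X g \<and> pathstart g = x \<and> pathfinish g = y"
      using Peano base assms unfolding Peano_continuum_def path_connected_def path_in_def by blast
    from someI_ex[OF this] False show ?thesis by (simp add: tail_def)
  qed
  then show "path_in X (tail y)" "pathstart (tail y) = x" "pathfinish (tail y) = y" by auto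
qed

lemma coset_of_cong: "homotopic_paths X p q \<Longrightarrow> coset_of p = coset_of q"
  by (simp add: coset_of_def loop_class_cong)

lemma coset_of_closed:
  assumes "path_in X p" "pathstart p = x" "pathfinish p = x"
  shows "coset_of p \<in> carrier Q"
  using loop_class_in_carrier[OF assms] by (auto simp: coset_of_def FactGroup_def RCOSETS_def)

lemma coset_of_join:
  assumes "path_in X p" "pathstart p = x" "pathfinish p = x"
    and "path_in X q" "pathstart q = x" "pathfinish q = x"
  shows "coset_of (p +++ q) = coset_of p \<otimes>\<^bsub>Q\<^esub> coset_of q"
  using loop_class_in_carrier[OF assms(1-3)] loop_class_in_carrier[OF assms(4-6)]
    rcos_sum[of "loop_class X x p" "loop_class X x q"] loop_class_mult[OF assms]
  unfolding coset_of_def mult_FactGroup by metis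

lemma hol_cong:
  assumes "homotopic_paths X p q" shows "hol p = hol q"
proof -
  have *: "path_in X p" "path_in X q" "pathstart p = pathstart q" "pathfinish p = pathfinish q"
    using assms homotopic_paths_imp_pathfinish homotopic_paths_imp_pathstart
      homotopic_paths_imp_path homotopic_paths_imp_subset unfolding path_in_def by metis+
  then have "pathstart q \<in> X" "pathfinish q \<in> X" using path_in_endpoints by metis+
  then show ?thesis unfolding hol_def *(3,4)
    using * tail assms
    by (intro coset_of_cong homotopic_paths_join_path_in homotopic_paths_path_in_join) auto
qed

lemma hol_closed [simp]:
  assumes "path_in X p" shows "hol p \<in> carrier Q"
  using path_in_endpoints[OF assms] assms tail unfolding hol_def
  by (intro coset_of_closed) auto

text \<open>The first factor ends by traversing the tail of the common endpoint backwards, the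
  second begins by traversing it forwards, and the two cancel.\<close>

lemma hol_join:
  assumes "path_in X p" "path_in X q" "pathfinish p = pathstart q"
  shows "hol (p +++ q) = hol p \<otimes>\<^bsub>Q\<^esub> hol q"
proof -
  note [trans] = homotopic_paths_trans
  note e = path_in_endpoints[OF assms(1)] path_in_endpoints[OF assms(2)]
  define a b c where "a = tail (pathstart p)" and "b = tail (pathstart q)" and "c = tail (pathfinish q)"
  have abc: "path_in X a" "path_in X b" "path_in X c" "pathstart a = x" "pathfinish a = pathstart p"
    "pathstart b = x" "pathfinish b = pathstart q" "pathstart c = x" "pathfinish c = pathfinish q"
    using e tail by (auto simp: a_def b_def c_def)
  have "hol p \<otimes>\<^bsub>Q\<^esub> hol q = coset_of (((a +++ p) +++ reversepath b) +++ ((b +++ q) +++ reversepath c))"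
  proof -
    have "hol p = coset_of ((a +++ p) +++ reversepath b)" "hol q = coset_of ((b +++ q) +++ reversepath c)"
      by (simp_all add: hol_def a_def b_def c_def assms(3))
    then show ?thesis
      using abc assms coset_of_join[of "(a +++ p) +++ reversepath b" "(b +++ q) +++ reversepath c"]
      by simp
  qed
  also have "\<dots> = coset_of ((a +++ (p +++ q)) +++ reversepath c)"
  proof (rule coset_of_cong)
    have "homotopic_paths X (((a +++ p) +++ reversepath b) +++ ((b +++ q) +++ reversepath c))
      (((a +++ p) +++ reversepath b) +++ (b +++ (q +++ reversepath c)))"
      using abc assms by (intro homotopic_paths_path_in_join homotopic_paths_assoc') auto
    also have "homotopic_paths X \<dots> ((a +++ p) +++ (q +++ reversepath c))"
      using abc assms by (intro homotopic_paths_cancel) auto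
    also have "homotopic_paths X \<dots> (((a +++ p) +++ q) +++ reversepath c)"
      using abc assms by (intro homotopic_paths_sym[OF homotopic_paths_assoc']) auto
    also have "homotopic_paths X \<dots> ((a +++ (p +++ q)) +++ reversepath c)"
      using abc assms by (intro homotopic_paths_join_path_in homotopic_paths_assoc') auto
    finally show "homotopic_paths X (((a +++ p) +++ reversepath b) +++ ((b +++ q) +++ reversepath c))
      ((a +++ (p +++ q)) +++ reversepath c)" .
  qed
  also have "\<dots> = hol (p +++ q)"
    by (simp add: hol_def a_def c_def)
  finally show ?thesis by simp
qed

text \<open>A constant path equals its join with itself, so its image is an idempotent of a
  group.\<close>

lemma hol_const:
  assumes "y \<in> X" shows "hol (\<lambda>_. y) = \<one>\<^bsub>Q\<^esub>"
proof -
  have "hol ((\<lambda>_. y) +++ (\<lambda>_. y)) = hol (\<lambda>_. y)"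
    by (simp add: joinpaths_def)
  then show ?thesis
    using hol_join[of "\<lambda>_. y" "\<lambda>_. y"] path_in_const[OF assms] hol_closed[of "\<lambda>_. y"]
    by (simp del: mult_FactGroup one_FactGroup)
qed

lemma hol_reversepath:
  assumes "path_in X p" shows "hol (reversepath p) = inv\<^bsub>Q\<^esub> hol p"
proof -
  have "hol (reversepath p) \<otimes>\<^bsub>Q\<^esub> hol p = hol (reversepath p +++ p)"
    using assms by (intro hol_join[symmetric]) auto
  also have "\<dots> = \<one>\<^bsub>Q\<^esub>"
    using hol_cong[OF homotopic_paths_reversepath_join[OF assms]] hol_const path_in_endpoints[OF assms]
    by simp
  finally show ?thesis
    using assms by (intro Q.inv_equality[symmetric]) auto
qed

lemma hol_segment_join:
  assumes "path_in X p" "0 \<le> u" "u \<le> v" "v \<le> w" "w \<le> 1"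
  shows "hol (segment_of u w p) = hol (segment_of u v p) \<otimes>\<^bsub>Q\<^esub> hol (segment_of v w p)"
  using assms hol_join[of "segment_of u v p" "segment_of v w p"] path_in_segment_of[of X p]
    hol_cong[OF homotopic_paths_join_segments[OF assms]] by simp

lemma hol_eq_coset_of:
  assumes "path_in X p" "pathstart p = x" "pathfinish p = x"
  shows "hol p = coset_of p"
proof -
  note [trans] = homotopic_paths_trans
  let ?c = "\<lambda>_::real. x"
  have [simp]: "reversepath ?c = ?c" by (simp add: reversepath_def)
  have "hol p = coset_of ((?c +++ p) +++ ?c)"
    using assms by (simp add: hol_def tail_def)
  also have "\<dots> = coset_of p"
  proof (rule coset_of_cong)
    have "homotopic_paths X ((?c +++ p) +++ ?c) (p +++ ?c)"
      using homotopic_paths_const_join[of X p] assms path_in_const[OF base]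
      by (intro homotopic_paths_join_path_in) auto
    also have "homotopic_paths X \<dots> p"
      using homotopic_paths_join_const[of X p] assms by simp
    finally show "homotopic_paths X ((?c +++ p) +++ ?c) p" .
  qed
  finally show ?thesis .
qed

lemma hol_onto: "hol ` loops X x = carrier Q"
proof -
  have "hol ` loops X x = coset_of ` loops X x"
    by (intro image_cong refl hol_eq_coset_of loopsD)
  then show ?thesis
    by (auto simp: FactGroup_def RCOSETS_def fundamental_group_def coset_of_def)
qed

text \<open>This is the link between the quotient and the loop space. Members of
  \<open>\<Union>G\<close> are extensional, hence the restriction.\<close>

lemma hol_eq_one_iff:
  assumes "path_in X p" "pathstart p = x" "pathfinish p = x"
  shows "hol p = \<one>\<^bsub>Q\<^esub> \<longleftrightarrow> restrict p {0..1} \<in> \<Union>G"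
proof -
  let ?q = "restrict p {0..1}"
  note q = restrict_in_loops[OF assms]
  have pq: "loop_class X x p = loop_class X x ?q"
    using q(2) by (rule loop_class_cong)
  have "hol p = \<one>\<^bsub>Q\<^esub> \<longleftrightarrow> loop_class X x p \<in> G"
  proof -
    have "G #>\<^bsub>fundamental_group X x\<^esub> loop_class X x p = G \<longleftrightarrow> loop_class X x p \<in> G"
      using coset_join1[OF _ _ is_subgroup] coset_join2[OF _ is_subgroup]
        loop_class_in_carrier[OF assms] by blast
    then show ?thesis using hol_eq_coset_of[OF assms] by (simp add: coset_of_def)
  qed
  also have "\<dots> \<longleftrightarrow> ?q \<in> \<Union>G"
  proof
    assume "loop_class X x p \<in> G"
    then show "?q \<in> \<Union>G" using q unfolding loop_class_def by blast
  next
    \<comment> \<open>Distinct classes are disjoint, so the member of \<open>G\<close> that contains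
      \<open>?q\<close> is the class of \<open>?q\<close>.\<close>
    assume "?q \<in> \<Union>G"
    then obtain a where a: "a \<in> G" "?q \<in> a" by blast
    then have "a \<in> carrier (fundamental_group X x)" using subset by blast
    then obtain r where "a = loop_class X x r" by (auto simp: fundamental_group_def)
    with a have "a = loop_class X x ?q"
      using loop_class_cong unfolding loop_class_def by blast
    then show "loop_class X x p \<in> G" using a pq by simp
  qed
  finally show ?thesis .
qed

end

section \<open>Small loops\<close>

lemma mdist_loop_space_le:
  assumes "p \<in> loops X x" "q \<in> loops X x" "\<And>t. t \<in> {0..1} \<Longrightarrow> dist (p t) (q t) \<le> e"
  shows "mdist (loop_space X x) p q \<le> e"
  unfolding mdist_loop_space[OF assms(1,2)] using assms(3) by (intro cSUP_least) auto

lemma dist_le_mdist_loop_space: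
  assumes "p \<in> loops X x" "q \<in> loops X x" "t \<in> {0..1}"
  shows "dist (p t) (q t) \<le> mdist (loop_space X x) p q"
proof -
  have "continuous_on {0..1} (\<lambda>t. dist (p t) (q t))"
    using assms by (intro continuous_on_dist) (auto simp: loops_def path_def)
  then have "bdd_above ((\<lambda>t. dist (p t) (q t)) ` {0..1})"
    by (intro bounded_imp_bdd_above compact_imp_bounded compact_continuous_image) auto
  then show ?thesis
    unfolding mdist_loop_space[OF assms(1,2)] using assms(3) by (intro cSUP_upper)
qed

lemma path_subdivision:
  fixes p :: "real \<Rightarrow> 'a::metric_space"
  assumes "path p" "0 < e"
  obtains d where "0 < d"
    "\<And>s t. \<lbrakk>s \<in> {0..1}; t \<in> {0..1}; \<bar>s - t\<bar> < d\<rbrakk> \<Longrightarrow> dist (p s) (p t) < e"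
proof -
  have "uniformly_continuous_on {0..1} p"
    using assms by (intro compact_uniformly_continuous) (auto simp: path_def)
  then show thesis
    using that assms unfolding uniformly_continuous_on_def by (metis dist_real_def dist_commute)
qed

lemma path_in_Int_ball_segment:
  assumes "path_in X p" "0 \<le> s" "s \<le> t" "t \<le> 1"
    and "\<And>r. r \<in> {s..t} \<Longrightarrow> dist y (p r) < e"
  shows "path_in (X \<inter> ball y e) (segment_of s t p)"
  using path_in_segment_of[OF assms(1-4)] assms(5) segment_of_arg(1)[OF assms(2-4)]
  by (auto simp: path_in_def path_image_def segment_of_apply image_subset_iff)

lemma path_in_IntD: "path_in (X \<inter> B) p \<Longrightarrow> path_in X p"
  by (auto simp: path_in_def)

section \<open>The open case: small loops die in the quotient, which is then finitely
  generated\<close>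

context Peano_quotient
begin

text \<open>This pointwise form, with loops based at the centre, is the one whose failure supplies
  the shrinking loops. The uniform form below, with closed paths starting anywhere in the ball, is
  the one used for cutting and gluing.\<close>

definition loops_killed_at :: "'a \<Rightarrow> real \<Rightarrow> bool" where
  "loops_killed_at y e \<longleftrightarrow> (\<forall>q. path_in (X \<inter> ball y e) q \<and> pathstart q = y \<and> pathfinish q = y
     \<longrightarrow> hol q = \<one>\<^bsub>Q\<^esub>)"

definition small_loops_killed :: "real \<Rightarrow> bool" where
  "small_loops_killed e \<longleftrightarrow> (\<forall>y\<in>X. \<forall>q. path_in (X \<inter> ball y e) q \<and> pathstart q = pathfinish q
     \<longrightarrow> hol q = \<one>\<^bsub>Q\<^esub>)"

text \<open>Conjugation does not affect whether a loop is killed, which allows loops to be moved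
  between base points along \<open>g\<close>.\<close>

lemma hol_conjugate:
  assumes "path_in X g" "path_in X q" "pathstart q = pathfinish g" "pathfinish q = pathfinish g"
  shows "hol ((g +++ q) +++ reversepath g) = hol g \<otimes>\<^bsub>Q\<^esub> hol q \<otimes>\<^bsub>Q\<^esub> inv\<^bsub>Q\<^esub> hol g"
    and "hol ((g +++ q) +++ reversepath g) = \<one>\<^bsub>Q\<^esub> \<longleftrightarrow> hol q = \<one>\<^bsub>Q\<^esub>"
proof -
  show *: "hol ((g +++ q) +++ reversepath g) = hol g \<otimes>\<^bsub>Q\<^esub> hol q \<otimes>\<^bsub>Q\<^esub> inv\<^bsub>Q\<^esub> hol g"
    using assms by (simp add: hol_join hol_reversepath del: mult_FactGroup one_FactGroup)
  have c: "hol g \<in> carrier Q" "hol q \<in> carrier Q" using assms by auto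
  show "hol ((g +++ q) +++ reversepath g) = \<one>\<^bsub>Q\<^esub> \<longleftrightarrow> hol q = \<one>\<^bsub>Q\<^esub>"
  proof
    assume "hol ((g +++ q) +++ reversepath g) = \<one>\<^bsub>Q\<^esub>"
    then have "hol g \<otimes>\<^bsub>Q\<^esub> hol q = hol g \<otimes>\<^bsub>Q\<^esub> \<one>\<^bsub>Q\<^esub>"
      unfolding * using c by (metis Q.inv_closed Q.inv_equality Q.inv_inv Q.m_closed Q.r_one)
    then show "hol q = \<one>\<^bsub>Q\<^esub>" using c by (simp del: mult_FactGroup one_FactGroup)
  qed (use c in \<open>simp add: * del: mult_FactGroup one_FactGroup\<close>)
qed

text \<open>The path \<open>p\<close> followed by the reverse of \<open>q\<close> is a closed path
  in the ball.\<close>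

lemma hol_eq_small:
  assumes "small_loops_killed e" "y \<in> X"
    "path_in (X \<inter> ball y e) p" "path_in (X \<inter> ball y e) q"
    "pathstart p = pathstart q" "pathfinish p = pathfinish q"
  shows "hol p = hol q"
proof -
  have X: "path_in X p" "path_in X q" using assms path_in_IntD by metis+
  have "hol (p +++ reversepath q) = \<one>\<^bsub>Q\<^esub>"
    using assms unfolding small_loops_killed_def by auto
  moreover have "hol (p +++ reversepath q) = hol p \<otimes>\<^bsub>Q\<^esub> inv\<^bsub>Q\<^esub> hol q"
    using X assms by (simp add: hol_join hol_reversepath del: mult_FactGroup)
  ultimately show ?thesis
    using X by (metis Q.inv_closed Q.inv_equality Q.inv_inv hol_closed)
qed

lemma small_loops_killed_if_pointwise:
  assumes "\<And>y. y \<in> X \<Longrightarrow> \<exists>e>0. loops_killed_at y e"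
  obtains e where "0 < e" "small_loops_killed e"
proof -
  have "\<exists>r>0. \<forall>q. path_in (X \<inter> ball y r) q \<and> pathstart q = pathfinish q \<longrightarrow> hol q = \<one>\<^bsub>Q\<^esub>"
    if y: "y \<in> X" for y
  proof -
    obtain e where e: "0 < e" "loops_killed_at y e" using assms[OF y] by blast
    obtain d where d: "0 < d" "\<And>b. \<lbrakk>b \<in> X; dist y b < d\<rbrakk> \<Longrightarrow>
       \<exists>g. path_in (X \<inter> ball y e) g \<and> pathstart g = y \<and> pathfinish g = b"
      using Peano_continuum_uniformly_lpc[OF Peano e(1)] y by metis
    show ?thesis
    \<comment> \<open>The bound \<open>d\<close> lets \<open>y\<close> be joined to the start of
      \<open>q\<close> inside the ball of radius \<open>e\<close>, and the bound \<open>e\<close>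
      keeps \<open>q\<close> in that ball. Conjugating then gives a loop based at
      \<open>y\<close>.\<close>
    proof (intro exI[of _ "min d e"] conjI allI impI)
      fix q assume q: "path_in (X \<inter> ball y (min d e)) q \<and> pathstart q = pathfinish q"
      then have "pathstart q \<in> X" "dist y (pathstart q) < d"
        using path_in_endpoints(1)[of "X \<inter> ball y (min d e)" q] by auto
      then obtain g where g: "path_in (X \<inter> ball y e) g" "pathstart g = y" "pathfinish g = pathstart q"
        using d by blast
      have qe: "path_in (X \<inter> ball y e) q"
        using q by (intro path_in_mono[of "X \<inter> ball y (min d e)" q "X \<inter> ball y e"]) auto
      have "hol ((g +++ q) +++ reversepath g) = \<one>\<^bsub>Q\<^esub>"
        using e(2) g q qe unfolding loops_killed_at_def by auto
      moreover have "hol ((g +++ q) +++ reversepath g) = \<one>\<^bsub>Q\<^esub> \<longleftrightarrow> hol q = \<one>\<^bsub>Q\<^esub>"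
        using path_in_IntD[OF g(1)] path_in_IntD[OF qe] g(3) q
        by (intro hol_conjugate(2)) simp_all
      ultimately show "hol q = \<one>\<^bsub>Q\<^esub>" by blast
    qed (use d e in auto)
  qed
  then obtain r where r: "\<And>y. y \<in> X \<Longrightarrow> 0 < r y"
    "\<And>y q. y \<in> X \<Longrightarrow> path_in (X \<inter> ball y (r y)) q \<Longrightarrow> pathstart q = pathfinish q \<Longrightarrow> hol q = \<one>\<^bsub>Q\<^esub>"
    by metis
  \<comment> \<open>A Lebesgue number of the cover by these balls makes the radius uniform.\<close>
  have "compact X" using Peano by (simp add: Peano_continuum_def)
  moreover have "X \<subseteq> \<Union>((\<lambda>y. ball y (r y)) ` X)" using r(1) by auto
  moreover have "open B" if "B \<in> (\<lambda>y. ball y (r y)) ` X" for B using that by auto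
  ultimately obtain e where e: "0 < e" "\<And>y. y \<in> X \<Longrightarrow> \<exists>B \<in> (\<lambda>y. ball y (r y)) ` X. ball y e \<subseteq> B"
    using Heine_Borel_lemma[of X "(\<lambda>y. ball y (r y)) ` X"] by metis
  have "small_loops_killed e"
    unfolding small_loops_killed_def
  proof (intro ballI allI impI)
    fix y q assume y: "y \<in> X" and q: "path_in (X \<inter> ball y e) q \<and> pathstart q = pathfinish q"
    obtain z where z: "z \<in> X" "ball y e \<subseteq> ball z (r z)" using e(2)[OF y] by blast
    then have "path_in (X \<inter> ball z (r z)) q"
      using q path_in_mono[of "X \<inter> ball y e" q "X \<inter> ball z (r z)"] by blast
    then show "hol q = \<one>\<^bsub>Q\<^esub>" using r(2) z q by blast
  qed
  then show thesis using that e by blast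
qed

lemma Union_subset_loops: "\<Union>G \<subseteq> loops X x"
  using subset by (auto simp: fundamental_group_def loop_class_def)

text \<open>Conjugated by the tail of \<open>y\<close>, the constant loop lies in
  \<open>\<Union>G\<close>. Replacing the constant loop by a short loop \<open>q\<close> changes the
  result only while \<open>q\<close> runs, so it stays in a given neighbourhood.\<close>

lemma loops_killed_at_if_open:
  assumes op: "openin (mtopology_of (loop_space X x)) (\<Union>G)" and y: "y \<in> X"
  shows "\<exists>e>0. loops_killed_at y e"
proof -
  interpret L: Metric_space "loops X x" "mdist (loop_space X x)"
    using Metric_space_mspace_mdist[of "loop_space X x"] by simp
  have L: "mtopology_of (loop_space X x) = L.mtopology"
    by (simp add: mtopology_of_def)
  define loop where "loop q = (tail y +++ q) +++ reversepath (tail y)" for q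
  note a = tail[OF y]
  have loop: "path_in X (loop q)" "pathstart (loop q) = x" "pathfinish (loop q) = x"
      "hol (loop q) = \<one>\<^bsub>Q\<^esub> \<longleftrightarrow> hol q = \<one>\<^bsub>Q\<^esub>"
    if "path_in X q" "pathstart q = y" "pathfinish q = y" for q
    using that a hol_conjugate(2)[of "tail y" q] by (auto simp: loop_def)
  let ?c = "\<lambda>_::real. y"
  have c: "path_in X ?c" using path_in_const[OF y] .
  have "restrict (loop ?c) {0..1} \<in> \<Union>G"
    using hol_eq_one_iff[OF loop(1-3)[OF c]] loop(4)[OF c] hol_const[OF y] by simp
  then obtain e where e: "0 < e" "L.mball (restrict (loop ?c) {0..1}) e \<subseteq> \<Union>G"
    using op unfolding L L.openin_mtopology by blast
  \<comment> \<open>Pointwise bounds give only a weak inequality for the supremum, so half the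
    radius is used to stay in the open ball.\<close>
  have "loops_killed_at y (e/2)"
    unfolding loops_killed_at_def
  proof (intro allI impI)
    fix q assume "path_in (X \<inter> ball y (e/2)) q \<and> pathstart q = y \<and> pathfinish q = y"
    then have q: "path_in (X \<inter> ball y (e/2)) q" "path_in X q" "pathstart q = y" "pathfinish q = y"
      using path_in_IntD by metis+
    have "dist (loop ?c t) (loop q t) \<le> e/2" if "t \<in> {0..1}" for t
    proof -
      have "dist y (q s) \<le> e/2" if "s \<in> {0..1}" for s
        using path_in_apply[OF q(1) that] by auto
      then show ?thesis
        using that e(1) by (auto simp: loop_def joinpaths_def)
    qed
    then have "mdist (loop_space X x) (restrict (loop ?c) {0..1}) (restrict (loop q) {0..1}) \<le> e/2"
      using restrict_in_loops(1)[OF loop(1-3)[OF c]] restrict_in_loops(1)[OF loop(1-3)[OF q(2-)]]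
      by (intro mdist_loop_space_le) auto
    then have "restrict (loop q) {0..1} \<in> L.mball (restrict (loop ?c) {0..1}) e"
      using e(1) restrict_in_loops(1)[OF loop(1-3)[OF c]] restrict_in_loops(1)[OF loop(1-3)[OF q(2-)]]
      by auto
    then have "hol (loop q) = \<one>\<^bsub>Q\<^esub>"
      using e(2) hol_eq_one_iff[OF loop(1-3)[OF q(2-)]] by blast
    then show "hol q = \<one>\<^bsub>Q\<^esub>" using loop(4)[OF q(2-)] by simp
  qed
  then show ?thesis using e(1) by (intro exI[of _ "e/2"]) auto
qed

text \<open>A ladder: the rungs \<open>g t\<close> lead from \<open>p t\<close> to
  \<open>q t\<close>. Over a short parameter interval both ways around a square stay in one ball
  about \<open>p s\<close> and so have the same image. Induction along the ladder leaves only the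
  two outer rungs, which are closed paths and hence killed.\<close>

lemma hol_eq_of_close:
  assumes e: "0 < e" "small_loops_killed e"
    and p: "path_in X p" and q: "path_in X q"
    and conn: "\<And>t. t \<in> {0..1} \<Longrightarrow>
      \<exists>g. path_in (X \<inter> ball (p t) (e/4)) g \<and> pathstart g = p t \<and> pathfinish g = q t"
    and ends: "pathstart q = pathstart p" "pathfinish q = pathfinish p"
  shows "hol p = hol q"
proof -
  obtain g where g: "\<And>t. t \<in> {0..1} \<Longrightarrow> path_in (X \<inter> ball (p t) (e/4)) (g t)"
    "\<And>t. t \<in> {0..1} \<Longrightarrow> pathstart (g t) = p t" "\<And>t. t \<in> {0..1} \<Longrightarrow> pathfinish (g t) = q t"
    using conn by metis
  have gX: "path_in X (g t)" if "t \<in> {0..1}" for t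
    using g(1)[OF that] by (rule path_in_IntD)
  have g_loop: "hol (g t) = \<one>\<^bsub>Q\<^esub>" if "t \<in> {0..1}" "p t = q t" for t
  proof -
    have "path_in (X \<inter> ball (p t) e) (g t)"
      using g(1)[OF that(1)] by (rule path_in_mono) (use e in auto)
    then show ?thesis
      using e(2) g that path_in_apply[OF p that(1)] unfolding small_loops_killed_def by metis
  qed
  have "0 < e/4" using e by simp
  obtain d1 where d1: "0 < d1"
    "\<And>s t. \<lbrakk>s \<in> {0..1}; t \<in> {0..1}; \<bar>s - t\<bar> < d1\<rbrakk> \<Longrightarrow> dist (p s) (p t) < e/4"
    using path_subdivision[OF _ \<open>0 < e/4\<close>, of p] p unfolding path_in_def by metis
  obtain d2 where d2: "0 < d2"
    "\<And>s t. \<lbrakk>s \<in> {0..1}; t \<in> {0..1}; \<bar>s - t\<bar> < d2\<rbrakk> \<Longrightarrow> dist (q s) (q t) < e/4"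
    using path_subdivision[OF _ \<open>0 < e/4\<close>, of q] q unfolding path_in_def by metis
  \<comment> \<open>One square. Each of its four sides stays within \<open>e/4 + e/4\<close> of
    \<open>p s\<close>: one quarter for moving along \<open>p\<close> or \<open>q\<close>, one for a
    rung.\<close>
  have step: "hol (segment_of s t p) \<otimes>\<^bsub>Q\<^esub> hol (g t) = hol (g s) \<otimes>\<^bsub>Q\<^esub> hol (segment_of s t q)"
    if st: "0 \<le> s" "s \<le> t" "t \<le> 1" "t - s < d1" "t - s < d2" for s t
  proof -
    have pX: "path_in X (segment_of s t p)" "path_in X (segment_of s t q)"
      using path_in_segment_of p q st by blast+
    have gs: "path_in (X \<inter> ball (p s) e) (g s)"
      using g(1)[of s] by (rule path_in_mono) (use e st in auto)
    have gt: "path_in (X \<inter> ball (p s) e) (g t)"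
    proof (rule path_in_mono[OF g(1)[of t]])
      have "dist (p s) (p t) < e/4" using d1 st by auto
      then show "X \<inter> ball (p t) (e/4) \<subseteq> X \<inter> ball (p s) e"
        using e dist_triangle[of "p s" _ "p t"] by (auto simp: subset_iff) (smt (verit) field_sum_of_halves)
    qed (use st in auto)
    have sp: "path_in (X \<inter> ball (p s) e) (segment_of s t p)"
    proof (rule path_in_Int_ball_segment[OF p])
      fix r assume "r \<in> {s..t}"
      then show "dist (p s) (p r) < e" using d1(2)[of s r] st e by auto
    qed (use st in auto)
    have "q s \<in> ball (p s) (e/4)"
      using path_in_endpoints(2)[OF g(1)[of s]] g(3)[of s] st by auto
    have sq: "path_in (X \<inter> ball (p s) e) (segment_of s t q)"
    proof (rule path_in_Int_ball_segment[OF q])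
      fix r assume "r \<in> {s..t}"
      then have "dist (q s) (q r) < e/4" using d2(2)[of s r] st by auto
      then show "dist (p s) (q r) < e" using \<open>q s \<in> ball (p s) (e/4)\<close> e dist_triangle[of "p s" "q r" "q s"]
        by auto
    qed (use st in auto)
    have "hol (segment_of s t p +++ g t) = hol (g s +++ segment_of s t q)"
      using sp sq gs gt g st path_in_apply[OF p, of s]
      by (intro hol_eq_small[OF e(2), of "p s"]) auto
    then show ?thesis
      using pX gX g st hol_join[of "segment_of s t p" "g t"] hol_join[of "g s" "segment_of s t q"]
      by auto
  qed
  obtain N where N: "0 < N" "1 / real N < min d1 d2"
  proof -
    obtain N where "inverse (real (Suc N)) < min d1 d2"
      using reals_Archimedean[of "min d1 d2"] d1 d2 by auto
    then show thesis using that[of "Suc N"] by (simp add: inverse_eq_divide)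
  qed
  have pq: "p 0 = q 0" "p 1 = q 1" using ends by (auto simp: pathstart_def pathfinish_def)
  \<comment> \<open>The rung at parameter 0 is killed, so it does not appear on the right.\<close>
  have "hol (segment_of 0 (i / N) p) \<otimes>\<^bsub>Q\<^esub> hol (g (i / N)) = hol (segment_of 0 (i / N) q)"
    if "i \<le> N" for i
    using that
  proof (induction i)
    case 0
    have "segment_of 0 0 p = (\<lambda>_. p 0)" "segment_of 0 0 q = (\<lambda>_. p 0)"
      using pq by (auto simp: segment_of_apply)
    then show ?case
      using g_loop[of 0] pq path_in_apply[OF p, of 0] hol_const[of "p 0"] by (simp del: mult_FactGroup one_FactGroup)
  next
    case (Suc i)
    define s t where "s = real i / N" and "t = real (Suc i) / N"
    have st: "0 \<le> s" "s \<le> t" "t \<le> 1" "t - s < d1" "t - s < d2"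
      using Suc.prems N by (auto simp: s_def t_def field_simps)
    have c: "hol (segment_of 0 s p) \<in> carrier Q" "hol (segment_of s t p) \<in> carrier Q" "hol (g t) \<in> carrier Q"
      "hol (g s) \<in> carrier Q" "hol (segment_of s t q) \<in> carrier Q"
      using path_in_segment_of[OF p, of 0 s] path_in_segment_of[OF p, of s t]
       path_in_segment_of[OF q, of s t] gX st by auto
    have "hol (segment_of 0 t p) \<otimes>\<^bsub>Q\<^esub> hol (g t)
        = hol (segment_of 0 s p) \<otimes>\<^bsub>Q\<^esub> (hol (segment_of s t p) \<otimes>\<^bsub>Q\<^esub> hol (g t))"
      using hol_segment_join[OF p, of 0 s t] st c Q.m_assoc by simp
    also have "\<dots> = (hol (segment_of 0 s p) \<otimes>\<^bsub>Q\<^esub> hol (g s)) \<otimes>\<^bsub>Q\<^esub> hol (segment_of s t q)"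
      using step[OF st] c Q.m_assoc by simp
    also have "\<dots> = hol (segment_of 0 s q) \<otimes>\<^bsub>Q\<^esub> hol (segment_of s t q)"
      using Suc by (simp add: s_def)
    also have "\<dots> = hol (segment_of 0 t q)"
      using hol_segment_join[OF q, of 0 s t] st by simp
    finally show ?case by (simp add: t_def)
  qed
  from this[of N] have "hol p \<otimes>\<^bsub>Q\<^esub> hol (g 1) = hol q"
    using N by (simp add: segment_of_apply[abs_def])
  then show ?thesis using g_loop[of 1] pq p by (simp del: mult_FactGroup one_FactGroup)
qed

text \<open>Uniform local path connectedness supplies rungs between any two sufficiently close
  loops, so \<open>hol\<close> is locally constant on the loop space.\<close>

lemma open_if_small_loops_killed:
  assumes e: "0 < e" "small_loops_killed e"
  shows "openin (mtopology_of (loop_space X x)) (\<Union>G)"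
proof -
  interpret L: Metric_space "loops X x" "mdist (loop_space X x)"
    using Metric_space_mspace_mdist[of "loop_space X x"] by simp
  have L: "mtopology_of (loop_space X x) = L.mtopology"
    by (simp add: mtopology_of_def)
  have "0 < e/4" using e by simp
  obtain d where d: "0 < d" "\<And>a b. \<lbrakk>a \<in> X; b \<in> X; dist a b < d\<rbrakk> \<Longrightarrow>
       \<exists>g. path_in (X \<inter> ball a (e/4)) g \<and> pathstart g = a \<and> pathfinish g = b"
    using Peano_continuum_uniformly_lpc[OF Peano \<open>0 < e/4\<close>] by metis
  have "L.mball p d \<subseteq> \<Union>G" if p: "p \<in> \<Union>G" for p
  proof
    fix q assume q: "q \<in> L.mball p d"
    then have pq: "p \<in> loops X x" "q \<in> loops X x" by auto
    have "hol p = hol q"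
    proof (rule hol_eq_of_close[OF e])
      fix t :: real assume t: "t \<in> {0..1}"
      have "dist (p t) (q t) < d"
        using dist_le_mdist_loop_space[OF pq t] q by auto
      then show "\<exists>g. path_in (X \<inter> ball (p t) (e/4)) g \<and> pathstart g = p t \<and> pathfinish g = q t"
        using d(2) path_in_apply[OF _ t] loopsD(1) pq by metis
    qed (use loopsD pq in metis)+
    moreover have "restrict r {0..1} = r" if "r \<in> loops X x" for r
      using loopsD(4)[OF that] by (rule extensional_restrict)
    ultimately show "q \<in> \<Union>G"
      using hol_eq_one_iff[OF loopsD(1-3)[OF pq(1)]] hol_eq_one_iff[OF loopsD(1-3)[OF pq(2)]] pq p
      by simp
  qed
  then show ?thesis
    unfolding L L.openin_mtopology using d(1) Union_subset_loops by blast
qed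

text \<open>A loop is cut into short pieces, and each piece is extended at both ends to points of a
  finite net. The image of an extended piece depends only on its two net points, which leaves
  finitely many generators.\<close>

lemma finitely_generated_if_small_loops_killed:
  assumes e: "0 < e" "small_loops_killed e"
  shows "finitely_generated_group Q"
proof -
  \<comment> \<open>Up to four short distances add up below: from a net point to the start of a
    piece, across the piece, to the next net point, and along the connecting path there. The total
    \<open>e/2\<close> is below \<open>e\<close>.\<close>
  have "0 < e/8" using e by simp
  obtain d where d: "0 < d" "\<And>a b. \<lbrakk>a \<in> X; b \<in> X; dist a b < d\<rbrakk> \<Longrightarrow>
       \<exists>g. path_in (X \<inter> ball a (e/8)) g \<and> pathstart g = a \<and> pathfinish g = b"
    using Peano_continuum_uniformly_lpc[OF Peano \<open>0 < e/8\<close>] by metis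
  obtain K where K: "finite K" "K \<subseteq> X" "X \<subseteq> (\<Union>k\<in>K. ball k d)"
    using Peano d(1) seq_compact_imp_totally_bounded[of X]
    unfolding Peano_continuum_def compact_eq_seq_compact_metric by metis
  \<comment> \<open>The base point is added to the net and joined to itself by the constant path, so
    that extending a loop at \<open>x\<close> does not change its image.\<close>
  have "\<exists>g. path_in X g \<and> pathfinish g = y \<and> path_in (X \<inter> ball (pathstart g) (e/8)) g \<and>
      pathstart g \<in> insert x K \<and> (y = x \<longrightarrow> g = (\<lambda>_. x))" if y: "y \<in> X" for y
  proof (cases "y = x")
    case True
    then show ?thesis using path_in_const[of x X] path_in_const[of x "X \<inter> ball x (e/8)"] base e
      by (intro exI[of _ "\<lambda>_. x"]) auto
  next
    case False
    obtain k where k: "k \<in> K" "k \<in> X" "dist k y < d"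
      using y K(2,3) unfolding subset_iff by (metis UN_E mem_ball)
    then show ?thesis using d(2)[OF k(2) y k(3)] path_in_IntD False by (metis insertCI)
  qed
  then obtain h where h: "\<And>y. y \<in> X \<Longrightarrow> path_in X (h y)" "\<And>y. y \<in> X \<Longrightarrow> pathfinish (h y) = y"
    "\<And>y. y \<in> X \<Longrightarrow> path_in (X \<inter> ball (pathstart (h y)) (e/8)) (h y)"
    "\<And>y. y \<in> X \<Longrightarrow> pathstart (h y) \<in> insert x K" "h x = (\<lambda>_. x)"
    using base by metis
  define P where "P p = (h (pathstart p) +++ p) +++ reversepath (h (pathfinish p))" for p
  have P: "path_in X (P p)" "pathstart (P p) = pathstart (h (pathstart p))"
      "pathfinish (P p) = pathstart (h (pathfinish p))"
      "hol (P p) = hol (h (pathstart p)) \<otimes>\<^bsub>Q\<^esub> hol p \<otimes>\<^bsub>Q\<^esub> inv\<^bsub>Q\<^esub> hol (h (pathfinish p))"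
    if "path_in X p" for p
    using that h(1,2) path_in_endpoints[OF that]
    by (auto simp: P_def hol_join hol_reversepath simp del: mult_FactGroup)
  define small where "small p \<longleftrightarrow> path_in X p \<and> path_in (X \<inter> ball (pathstart p) (e/8)) p" for p
  have P_small: "path_in (X \<inter> ball (pathstart (P p)) e) (P p)" if p: "small p" for p
  proof -
    define y z where "y = pathstart p" and "z = pathfinish p"
    have yz: "y \<in> X" "z \<in> X" "dist y z < e/8"
      using p path_in_endpoints[of X p] path_in_endpoints[of "X \<inter> ball y (e/8)" p]
      by (auto simp: small_def y_def z_def)
    define k l where "k = pathstart (h y)" and "l = pathstart (h z)"
    have kl: "dist k y < e/8" "dist l z < e/8"
      using path_in_endpoints[OF h(3)[OF yz(1)]] path_in_endpoints[OF h(3)[OF yz(2)]]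
        h(2)[OF yz(1)] h(2)[OF yz(2)] by (auto simp: k_def l_def)
    have "path_in (X \<inter> ball k e) (h y)"
      using h(3)[OF yz(1)] by (rule path_in_mono) (use e in \<open>auto simp: k_def\<close>)
    moreover have "path_in (X \<inter> ball k e) p"
    proof (rule path_in_mono)
      show "path_in (X \<inter> ball y (e/8)) p" using p by (simp add: small_def y_def)
      show "X \<inter> ball y (e/8) \<subseteq> X \<inter> ball k e"
      proof
        fix w assume "w \<in> X \<inter> ball y (e/8)"
        then show "w \<in> X \<inter> ball k e" using dist_triangle[of k w y] kl e by auto
      qed
    qed
    moreover have "path_in (X \<inter> ball k e) (h z)"
    proof (rule path_in_mono)
      show "path_in (X \<inter> ball l (e/8)) (h z)" using h(3)[OF yz(2)] by (simp add: l_def)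
      show "X \<inter> ball l (e/8) \<subseteq> X \<inter> ball k e"
      proof
        fix w assume w: "w \<in> X \<inter> ball l (e/8)"
        have "dist k w \<le> dist k y + dist y z + dist l z + dist l w"
          using dist_triangle[of k w y] dist_triangle[of y w z] dist_triangle[of z w l]
          by (simp add: dist_commute)
        then show "w \<in> X \<inter> ball k e" using w kl yz e by auto
      qed
    qed
    ultimately show ?thesis
      using h(2) yz P(2)[of p] p by (auto simp: P_def y_def z_def k_def small_def)
  qed
  define A where "A = (\<lambda>p. hol (P p)) ` Collect small"
  have "finite A"
  proof (rule finite_subset)
    \<comment> \<open>One value is chosen for each pair of net points; by \<open>P_small\<close> and
      \<open>hol_eq_small\<close> it is the only possible one.\<close>
    let ?f = "\<lambda>(k, l). SOME v. \<exists>p. small p \<and> pathstart (P p) = k \<and> pathfinish (P p) = l \<and> v = hol (P p)"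
    show "finite (?f ` (insert x K \<times> insert x K))" using K by simp
    show "A \<subseteq> ?f ` (insert x K \<times> insert x K)"
    proof
      fix v assume "v \<in> A"
      then obtain p where p: "small p" "v = hol (P p)" by (auto simp: A_def)
      then have X: "path_in X p" by (simp add: small_def)
      let ?k = "pathstart (P p)" and ?l = "pathfinish (P p)"
      have "\<exists>v q. small q \<and> pathstart (P q) = ?k \<and> pathfinish (P q) = ?l \<and> v = hol (P q)"
        using p by blast
      from someI_ex[OF this] obtain q where q: "small q" "pathstart (P q) = ?k" "pathfinish (P q) = ?l"
        "?f (?k, ?l) = hol (P q)" by auto
      have v: "hol (P p) = hol (P q)"
        using P_small[OF p(1)] P_small[OF q(1)] q(2,3) path_in_endpoints(1)[OF P(1)[OF X]]
        by (intro hol_eq_small[OF e(2), of ?k]) auto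
      have "(?k, ?l) \<in> insert x K \<times> insert x K"
        unfolding P(2,3)[OF X] using h(4) path_in_endpoints[OF X] by blast
      moreover have "v = ?f (?k, ?l)" unfolding q(4) p(2) by (rule v)
      ultimately show "v \<in> ?f ` (insert x K \<times> insert x K)" by (rule rev_image_eqI)
    qed
  qed
  have A: "A \<subseteq> carrier Q"
    using P(1) by (auto simp: A_def small_def simp del: mult_FactGroup)
  \<comment> \<open>The connecting path at the middle point occurs once forwards and once backwards,
    so its image cancels.\<close>
  have P_join: "hol (P (segment_of u w p)) = hol (P (segment_of u v p)) \<otimes>\<^bsub>Q\<^esub> hol (P (segment_of v w p))"
    if p: "path_in X p" "0 \<le> u" "u \<le> v" "v \<le> w" "w \<le> 1" for p u v w
  proof -
    have s: "path_in X (segment_of u w p)" "path_in X (segment_of u v p)" "path_in X (segment_of v w p)"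
      using path_in_segment_of[OF p(1)] p by auto
    have uvw: "p u \<in> X" "p v \<in> X" "p w \<in> X" using path_in_apply[OF p(1)] p by auto
    define a b c where "a = hol (h (p u))" and "b = hol (h (p v))" and "c = hol (h (p w))"
    define f g where "f = hol (segment_of u v p)" and "g = hol (segment_of v w p)"
    have abc: "a \<in> carrier Q" "b \<in> carrier Q" "c \<in> carrier Q" "f \<in> carrier Q" "g \<in> carrier Q"
      using h(1) uvw s by (auto simp: a_def b_def c_def f_def g_def)
    have "inv\<^bsub>Q\<^esub> b \<otimes>\<^bsub>Q\<^esub> (b \<otimes>\<^bsub>Q\<^esub> (g \<otimes>\<^bsub>Q\<^esub> inv\<^bsub>Q\<^esub> c)) = g \<otimes>\<^bsub>Q\<^esub> inv\<^bsub>Q\<^esub> c"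
      using abc by (subst Q.m_assoc[symmetric]) (simp_all del: mult_FactGroup one_FactGroup)
    then have "(a \<otimes>\<^bsub>Q\<^esub> f \<otimes>\<^bsub>Q\<^esub> inv\<^bsub>Q\<^esub> b) \<otimes>\<^bsub>Q\<^esub> (b \<otimes>\<^bsub>Q\<^esub> g \<otimes>\<^bsub>Q\<^esub> inv\<^bsub>Q\<^esub> c)
        = a \<otimes>\<^bsub>Q\<^esub> (f \<otimes>\<^bsub>Q\<^esub> g) \<otimes>\<^bsub>Q\<^esub> inv\<^bsub>Q\<^esub> c"
      using abc by (simp add: Q.m_assoc del: mult_FactGroup one_FactGroup)
    then show ?thesis
      using P(4)[OF s(1)] P(4)[OF s(2)] P(4)[OF s(3)] hol_segment_join[OF p]
      by (simp add: a_def b_def c_def f_def g_def del: mult_FactGroup one_FactGroup)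
  qed
  have "hol p \<in> generate Q A" if "p \<in> loops X x" for p
  proof -
    note p = loopsD[OF that]
    obtain d1 where d1: "0 < d1"
      "\<And>s t. \<lbrakk>s \<in> {0..1}; t \<in> {0..1}; \<bar>s - t\<bar> < d1\<rbrakk> \<Longrightarrow> dist (p s) (p t) < e/8"
      using path_subdivision[OF _ \<open>0 < e/8\<close>, of p] p unfolding path_in_def by metis
    have small: "hol (P (segment_of s t p)) \<in> A" if st: "0 \<le> s" "s \<le> t" "t \<le> 1" "t - s < d1" for s t
    proof -
      have "path_in (X \<inter> ball (p s) (e/8)) (segment_of s t p)"
      proof (rule path_in_Int_ball_segment[OF p(1)])
        fix r assume "r \<in> {s..t}"
        then show "dist (p s) (p r) < e/8" using d1(2)[of s r] st by auto
      qed (use st in auto)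
      then have "small (segment_of s t p)"
        using path_in_segment_of[OF p(1)] st by (simp add: small_def)
      then show ?thesis by (auto simp: A_def)
    qed
    obtain N where N: "1 / real (Suc N) < d1"
      using reals_Archimedean[OF d1(1)] by (auto simp: inverse_eq_divide)
    have "hol (P (segment_of 0 (real i / real (Suc N)) p)) \<in> generate Q A" if "i \<le> Suc N" for i
      using that
    proof (induction i)
      case 0
      \<comment> \<open>The degenerate piece is short too, so its image is already a
        generator.\<close>
      then show ?case using small[of 0 0] d1(1) by (simp add: generate.incl)
    next
      case (Suc i)
      define s t where "s = real i / real (Suc N)" and "t = real (Suc i) / real (Suc N)"
      have st: "0 \<le> s" "s \<le> t" "t \<le> 1" "t - s < d1"
      proof -
        have "t - s = 1 / real (Suc N)"
          unfolding s_def t_def by (simp add: diff_divide_distrib[symmetric])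
        then show "t - s < d1" using N by simp
      qed (use Suc.prems in \<open>auto simp: s_def t_def divide_right_mono\<close>)
      have "hol (P (segment_of 0 s p)) \<otimes>\<^bsub>Q\<^esub> hol (P (segment_of s t p)) \<in> generate Q A"
      proof (rule generate.eng)
        show "hol (P (segment_of 0 s p)) \<in> generate Q A" using Suc by (simp add: s_def)
      qed (rule generate.incl[OF small[OF st]])
      then show ?case
        using P_join[OF p(1), of 0 s t] st by (simp add: t_def)
    qed
    from this[of "Suc N"] have "hol (P p) \<in> generate Q A"
      by (simp add: segment_of_apply[abs_def])
    moreover have "hol (P p) = hol p"
      using P(4)[OF p(1)] p h(5) hol_const[OF base] hol_closed[OF p(1)]
      by (simp del: mult_FactGroup one_FactGroup)
    ultimately show ?thesis by simp
  qed
  then have "carrier Q \<subseteq> generate Q A" unfolding hol_onto[symmetric] by blast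
  moreover have "generate Q A \<subseteq> carrier Q" using Q.generate_incl[OF A] .
  ultimately show ?thesis
    unfolding finitely_generated_group_def using \<open>finite A\<close> A by blast
qed

end

section \<open>Category in sequence spaces\<close>

lemma homeomorphic_map_nowhere_dense_in:
  assumes "homeomorphic_map X Y h" "nowhere_dense_in X A"
  shows "nowhere_dense_in Y (h ` A)"
proof -
  have A: "A \<subseteq> topspace X" using assms by (simp add: nowhere_dense_in_def)
  then have "h ` A \<subseteq> topspace Y"
    using homeomorphic_imp_surjective_map[OF assms(1)] by blast
  moreover have "Y interior_of (Y closure_of (h ` A)) = h ` (X interior_of (X closure_of A))"
    using homeomorphic_map_closure_of[OF assms(1) A]
      homeomorphic_map_interior_of[OF assms(1) closure_of_subset_topspace] by simp
  ultimately show ?thesis using assms(2) by (simp add: nowhere_dense_in_def)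
qed

lemma homeomorphic_map_meager_in:
  assumes h: "homeomorphic_map X Y h" and "meager_in X A"
  shows "meager_in Y (h ` A)"
proof -
  obtain \<U> where "countable \<U>" "\<U> \<subseteq> Collect (nowhere_dense_in X)" "\<Union>\<U> = A"
    using assms(2) unfolding meager_in_def union_of_def by blast
  then have "countable ((`) h ` \<U>)" "(`) h ` \<U> \<subseteq> Collect (nowhere_dense_in Y)" "\<Union>((`) h ` \<U>) = h ` A"
    using homeomorphic_map_nowhere_dense_in[OF h] by auto
  then show ?thesis
    unfolding meager_in_def union_of_def by blast
qed

lemma homeomorphic_map_has_BP_in:
  assumes h: "homeomorphic_map X Y h" and "has_BP_in X A"
  shows "has_BP_in Y (h ` A)"
proof -
  obtain U where U: "A \<subseteq> topspace X" "openin X U" "meager_in X (sym_diff A U)"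
    using assms(2) unfolding has_BP_in_def by blast
  note UX = openin_subset[OF U(2)]
  have inj: "inj_on h (topspace X)" by (rule homeomorphic_imp_injective_map[OF h])
  have "h ` sym_diff A U = sym_diff (h ` A) (h ` U)"
    using inj_on_image_set_diff[OF inj] U(1) UX by (auto simp: image_Un)
  then have "meager_in Y (sym_diff (h ` A) (h ` U))"
    using homeomorphic_map_meager_in[OF h U(3)] by simp
  moreover have "openin Y (h ` U)"
    using homeomorphic_map_openness[OF h UX] U(2) by simp
  moreover have "h ` A \<subseteq> topspace Y"
    using U(1) homeomorphic_imp_surjective_map[OF h] by blast
  ultimately show ?thesis unfolding has_BP_in_def by blast
qed

lemma meager_in_Un: "meager_in X A \<Longrightarrow> meager_in X B \<Longrightarrow> meager_in X (A \<union> B)"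
  unfolding meager_in_def by (rule countable_union_of_Un)

lemma Baire_not_meager_in:
  assumes "completely_metrizable_space X" "openin X U" "U \<noteq> {}" "meager_in X A"
  shows "\<not> U \<subseteq> A"
proof
  assume "U \<subseteq> A"
  obtain \<U> where \<U>: "countable \<U>" "\<U> \<subseteq> Collect (nowhere_dense_in X)" "\<Union>\<U> = A"
    using assms(4) unfolding meager_in_def union_of_def by blast
  have "X interior_of \<Union>((closure_of) X ` \<U>) = {}"
    using \<U> assms(1) by (intro Baire_category_alt) (auto simp: nowhere_dense_in_def)
  moreover have "A \<subseteq> \<Union>((closure_of) X ` \<U>)"
  proof
    fix a assume "a \<in> A"
    then obtain B where B: "B \<in> \<U>" "a \<in> B" using \<U>(3) by blast
    then have "nowhere_dense_in X B" using \<U>(2) by blast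
    then have "B \<subseteq> X closure_of B"
      by (intro closure_of_subset) (simp add: nowhere_dense_in_def)
    then show "a \<in> \<Union>((closure_of) X ` \<U>)" using B by blast
  qed
  then have "U \<subseteq> X interior_of \<Union>((closure_of) X ` \<U>)"
    using \<open>U \<subseteq> A\<close> assms(2) by (intro interior_of_maximal) auto
  ultimately show False using assms(3) by simp
qed

text \<open>The entries may have any type: sequences of pairs of bits stand for pairs of binary
  sequences, so that a relation between binary sequences becomes a subset of one sequence
  space.\<close>

definition seq_topology :: "(nat \<Rightarrow> 'b) topology" where
  "seq_topology = product_topology (\<lambda>_. discrete_topology UNIV) UNIV"

definition cylinder :: "nat \<Rightarrow> (nat \<Rightarrow> 'b) \<Rightarrow> (nat \<Rightarrow> 'b) set" where
  "cylinder n c = {c'. \<forall>i<n. c' i = c i}"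

lemma topspace_seq_topology [simp]: "topspace seq_topology = UNIV"
  by (simp add: seq_topology_def)

lemma openin_seq_topology:
  "openin seq_topology U \<longleftrightarrow> (\<forall>c\<in>U. \<exists>n. cylinder n c \<subseteq> U)"
proof
  assume U: "openin seq_topology U"
  show "\<forall>c\<in>U. \<exists>n. cylinder n c \<subseteq> U"
  proof
    fix c assume "c \<in> U"
    then obtain V :: "nat \<Rightarrow> 'a set" where V: "finite {i. V i \<noteq> UNIV}" "c \<in> Pi\<^sub>E UNIV V" "Pi\<^sub>E UNIV V \<subseteq> U"
      using U unfolding seq_topology_def openin_product_topology_alt by auto
    obtain n where "{i. V i \<noteq> UNIV} \<subseteq> {..<n}"
      using V(1) finite_nat_iff_bounded by blast
    then have n: "V i = UNIV" if "\<not> i < n" for i using that by auto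
    have "cylinder n c \<subseteq> Pi\<^sub>E UNIV V"
    proof
      fix c' assume c': "c' \<in> cylinder n c"
      have "c' i \<in> V i" for i
        using c' V(2) n[of i] by (cases "i < n") (auto simp: cylinder_def PiE_iff)
      then show "c' \<in> Pi\<^sub>E UNIV V" by auto
    qed
    then show "\<exists>n. cylinder n c \<subseteq> U" using V(3) by blast
  qed
next
  assume R: "\<forall>c\<in>U. \<exists>n. cylinder n c \<subseteq> U"
  show "openin seq_topology U"
    unfolding seq_topology_def openin_product_topology_alt
  proof
    fix c assume "c \<in> U"
    then obtain n where n: "cylinder n c \<subseteq> U" using R by blast
    define V where "V i = (if i < n then {c i} else UNIV)" for i
    have "{i. V i \<noteq> UNIV} \<subseteq> {..<n}" by (auto simp: V_def)
    then have "finite {i. V i \<noteq> UNIV}" by (rule finite_subset) simp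
    moreover have "c \<in> Pi\<^sub>E UNIV V" by (auto simp: V_def)
    moreover have "Pi\<^sub>E UNIV V \<subseteq> cylinder n c"
    proof
      fix c' assume "c' \<in> Pi\<^sub>E UNIV V"
      then have "c' i \<in> V i" for i by auto
      then show "c' \<in> cylinder n c" by (auto simp: cylinder_def V_def dest: meta_spec split: if_splits)
    qed
    ultimately show "\<exists>V. finite {i \<in> UNIV. V i \<noteq> topspace (discrete_topology UNIV)} \<and>
       (\<forall>i\<in>UNIV. openin (discrete_topology UNIV) (V i)) \<and> c \<in> Pi\<^sub>E UNIV V \<and> Pi\<^sub>E UNIV V \<subseteq> U"
      using n by (intro exI[of _ V]) auto
  qed
qed

lemma cylinder_self [simp]: "c \<in> cylinder n c"
  by (simp add: cylinder_def)

lemma cylinder_trans: "c' \<in> cylinder n c \<Longrightarrow> n \<le> m \<Longrightarrow> cylinder m c' \<subseteq> cylinder n c"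
  by (auto simp: cylinder_def)

lemma openin_cylinder: "openin seq_topology (cylinder n c)"
  unfolding openin_seq_topology using cylinder_trans by blast

lemma completely_metrizable_seq_topology: "completely_metrizable_space seq_topology"
  unfolding seq_topology_def completely_metrizable_space_product_topology
  by (simp add: completely_metrizable_space_discrete_topology)

lemma Polish_seq_topology: "Polish_space (seq_topology :: (nat \<Rightarrow> 'b::countable) topology)"
proof -
  define C where "C = range (\<lambda>(l :: 'b list) i. if i < length l then l ! i else undefined)"
  have "C \<inter> U \<noteq> {}" if "openin seq_topology U" "U \<noteq> {}" for U
  proof -
    obtain c n where c: "cylinder n c \<subseteq> U" using \<open>openin seq_topology U\<close> \<open>U \<noteq> {}\<close> unfolding openin_seq_topology by blast
    let ?c = "\<lambda>i. if i < length (map c [0..<n]) then map c [0..<n] ! i else undefined"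
    have "?c \<in> C" unfolding C_def by (rule rangeI)
    moreover have "?c \<in> cylinder n c" by (auto simp: cylinder_def)
    ultimately show ?thesis using c by blast
  qed
  then have "seq_topology closure_of C = topspace seq_topology"
    unfolding dense_intersects_open by blast
  moreover have "countable C" by (simp add: C_def)
  ultimately have "separable_space (seq_topology :: (nat \<Rightarrow> 'b) topology)"
    unfolding separable_space_def by (intro exI[of _ C]) simp
  then show ?thesis
    by (simp add: Polish_space_def completely_metrizable_seq_topology)
qed

text \<open>Being nowhere dense, in terms of finite words: every word has an extension none of whose
  continuations lies in \<open>A\<close>.\<close>

definition avoidable :: "(nat \<Rightarrow> 'b) set \<Rightarrow> bool" where
  "avoidable A \<longleftrightarrow> (\<forall>n c. \<exists>c'\<in>cylinder n c. \<exists>m\<ge>n. cylinder m c' \<inter> A = {})"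

lemma nowhere_dense_imp_avoidable:
  assumes "nowhere_dense_in seq_topology A"
  shows "avoidable A"
  unfolding avoidable_def
proof (intro allI)
  fix n c
  have "\<not> cylinder n c \<subseteq> seq_topology closure_of A"
    using assms interior_of_maximal[OF _ openin_cylinder, of n c] cylinder_self[of c n]
    unfolding nowhere_dense_in_def by blast
  then obtain c' where c': "c' \<in> cylinder n c" "c' \<in> UNIV - seq_topology closure_of A" by blast
  have "openin seq_topology (UNIV - seq_topology closure_of A)"
    using closedin_closure_of[of seq_topology A] by (simp add: closedin_def)
  then obtain m where "cylinder m c' \<subseteq> UNIV - seq_topology closure_of A"
    using c'(2) unfolding openin_seq_topology by blast
  moreover have "A \<subseteq> seq_topology closure_of A"
    by (intro closure_of_subset) simp
  moreover have "cylinder (max n m) c' \<subseteq> cylinder m c'"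
    by (intro cylinder_trans) auto
  ultimately have "cylinder (max n m) c' \<inter> A = {}" by blast
  then show "\<exists>c'\<in>cylinder n c. \<exists>m\<ge>n. cylinder m c' \<inter> A = {}"
    using c'(1) by (intro bexI[of _ c'] exI[of _ "max n m"]) auto
qed

lemma avoidable_Un:
  assumes "avoidable A" "avoidable B" shows "avoidable (A \<union> B)"
  unfolding avoidable_def
proof (intro allI)
  fix n c
  obtain c1 m1 where 1: "c1 \<in> cylinder n c" "m1 \<ge> n" "cylinder m1 c1 \<inter> A = {}"
    using assms(1) unfolding avoidable_def by metis
  obtain c2 m2 where 2: "c2 \<in> cylinder m1 c1" "m2 \<ge> m1" "cylinder m2 c2 \<inter> B = {}"
    using assms(2) unfolding avoidable_def by metis
  have "cylinder m2 c2 \<inter> (A \<union> B) = {}" "c2 \<in> cylinder n c"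
    using 1 2 cylinder_trans[OF 2(1,2)] cylinder_trans[OF 1(1,2)] by blast+
  then show "\<exists>c'\<in>cylinder n c. \<exists>m\<ge>n. cylinder m c' \<inter> (A \<union> B) = {}"
    using 1(2) 2(2) by (intro bexI[of _ c2] exI[of _ m2]) auto
qed

text \<open>The word \<open>w\<close> must avoid \<open>A\<close> whatever precedes it. Over a
  finite alphabet only finitely many prefixes of length \<open>n\<close> exist. They are treated one
  after the other, and lengthening \<open>w\<close> for a new prefix keeps the earlier ones
  avoided.\<close>

lemma avoiding_block:
  fixes A :: "(nat \<Rightarrow> 'b::finite) set"
  assumes "avoidable A"
  shows "\<exists>m>n. \<exists>w. \<forall>c. (\<forall>i\<in>{n..<m}. c i = w i) \<longrightarrow> c \<notin> A"
proof -
  have "\<exists>m>n. \<exists>w. \<forall>p\<in>S. \<forall>c. (\<forall>i<n. c i = p i) \<and> (\<forall>i\<in>{n..<m}. c i = w i) \<longrightarrow> c \<notin> A"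
    if "finite S" for S
    using that
  proof (induction S)
    case empty
    then show ?case by auto
  next
    case (insert p S)
    then obtain m w where m: "m > n"
      "\<forall>p\<in>S. \<forall>c. (\<forall>i<n. c i = p i) \<and> (\<forall>i\<in>{n..<m}. c i = w i) \<longrightarrow> c \<notin> A" by blast
    define c0 where "c0 = (\<lambda>i. if i < n then p i else w i)"
    obtain c' m' where c': "c' \<in> cylinder m c0" "m' \<ge> m" "cylinder m' c' \<inter> A = {}"
      using assms unfolding avoidable_def by metis
    have c'_i: "c' i = (if i < n then p i else w i)" if "i < m" for i
      using c'(1) that by (auto simp: cylinder_def c0_def)
    have "c \<notin> A" if q: "q \<in> insert p S" "\<forall>i<n. c i = q i" "\<forall>i\<in>{n..<m'}. c i = c' i" for q c
    proof (cases "q = p")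
      case True
      have "c i = c' i" if "i < m'" for i
        using q(2,3) c'_i[of i] m(1) that True by (cases "i < n") auto
      then have "c \<in> cylinder m' c'" by (simp add: cylinder_def)
      then show ?thesis using c'(3) by blast
    next
      case False
      have "\<forall>i\<in>{n..<m}. c i = w i" using q(3) c'_i c'(2) by auto
      then show ?thesis using m(2) q False by blast
    qed
    then show ?case using m(1) c'(2) by (intro exI[of _ m'] conjI exI[of _ c']) auto
  qed
  moreover have "finite ({..<n} \<rightarrow>\<^sub>E (UNIV :: 'b set))" by (simp add: finite_PiE)
  ultimately obtain m w where m: "m > n" "\<forall>p\<in>{..<n} \<rightarrow>\<^sub>E (UNIV :: 'b set).
      \<forall>c. (\<forall>i<n. c i = p i) \<and> (\<forall>i\<in>{n..<m}. c i = w i) \<longrightarrow> c \<notin> A" by blast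
  have "c \<notin> A" if "\<forall>i\<in>{n..<m}. c i = w i" for c
    using bspec[OF m(2), of "restrict c {..<n}"] that by auto
  then show ?thesis using m(1) by blast
qed

text \<open>Write \<open>A\<close> as a union of nowhere dense sets \<open>F j\<close>. The pattern
  on block \<open>k\<close> avoids all \<open>F j\<close> with \<open>j \<le> k\<close>, so
  following infinitely many patterns avoids every \<open>F j\<close>.\<close>

lemma meager_avoiding_blocks:
  fixes A :: "(nat \<Rightarrow> 'b::finite) set"
  assumes "meager_in seq_topology A"
  obtains N :: "nat \<Rightarrow> nat" and W :: "nat \<Rightarrow> nat \<Rightarrow> 'b" where "strict_mono N"
    "\<And>c. infinite {k. \<forall>i\<in>{N k..<N (Suc k)}. c i = W k i} \<Longrightarrow> c \<notin> A"
proof -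
  obtain \<U> where \<U>: "countable \<U>" "\<U> \<subseteq> Collect (nowhere_dense_in seq_topology)" "\<Union>\<U> = A"
    using assms unfolding meager_in_def union_of_def by blast
  have nd_empty: "nowhere_dense_in seq_topology ({} :: (nat \<Rightarrow> 'b) set)" by (simp add: nowhere_dense_in_def)
  \<comment> \<open>The empty set is inserted because an enumeration needs a nonempty
    family.\<close>
  define F where "F = from_nat_into (insert {} \<U>)"
  have "range F = insert {} \<U>" unfolding F_def using \<U>(1) by (intro range_from_nat_into) auto
  then have "F j \<in> insert {} \<U>" "A = (\<Union>j. F j)" for j
    using \<U>(3) by auto
  moreover have "nowhere_dense_in seq_topology B" if "B \<in> insert {} \<U>" for B
    using that \<U>(2) nd_empty by blast
  ultimately have F: "nowhere_dense_in seq_topology (F j)" "A = (\<Union>j. F j)" for j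
    by blast+
  have H: "avoidable (\<Union>j\<le>k. F j)" for k
    by (induction k) (simp_all add: atMost_Suc avoidable_Un nowhere_dense_imp_avoidable F)
  define P where "P k n m w \<longleftrightarrow> n < m \<and> (\<forall>c. (\<forall>i\<in>{n..<m}. c i = w i) \<longrightarrow> c \<notin> (\<Union>j\<le>k. F j))"
    for k n m and w :: "nat \<Rightarrow> 'b"
  have "\<exists>m w. P k n m w" for k n
    using avoiding_block[OF H[of k], of n] unfolding P_def by blast
  then obtain m w where mw: "\<And>k n. P k n (m k n) (w k n)" by metis
  \<comment> \<open>Each block starts where the previous one ends:
    \<open>N (Suc k) = m k (N k)\<close>.\<close>
  define N where "N = rec_nat 0 m"
  have N: "P k (N k) (N (Suc k)) (w k (N k))" for k
    using mw by (simp add: N_def)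
  show thesis
  proof (rule that)
    show "strict_mono N"
      using N by (auto simp: strict_mono_Suc_iff P_def)
    fix c assume inf: "infinite {k. \<forall>i\<in>{N k..<N (Suc k)}. c i = w k (N k) i}"
    show "c \<notin> A"
    proof
      assume "c \<in> A"
      then obtain j where j: "c \<in> F j" using F by blast
      obtain k where k: "j \<le> k" "\<forall>i\<in>{N k..<N (Suc k)}. c i = w k (N k) i"
        using inf unfolding infinite_nat_iff_unbounded_le by blast
      then have "c \<notin> (\<Union>j\<le>k. F j)" using N[of k] unfolding P_def by blast
      then show False using j k(1) by blast
    qed
  qed
qed

text \<open>
  Mycielski's theorem.  Block \<open>k\<close> codes a pair of words \<open>s\<close>, \<open>t\<close>; the point with index \<open>u\<close> follows the
  first half of the avoiding pattern there if \<open>s\<close> is an initial word of \<open>u\<close>, and the second half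
  otherwise.  Two distinct indices realise the whole pattern on every block that codes their
  initial words of some common, sufficiently large length.
\<close>

lemma Mycielski:
  fixes E :: "(nat \<Rightarrow> bool) \<Rightarrow> (nat \<Rightarrow> bool) \<Rightarrow> bool"
  assumes "meager_in seq_topology {c. E (fst \<circ> c) (snd \<circ> c)}"
  obtains f :: "(nat \<Rightarrow> bool) \<Rightarrow> nat \<Rightarrow> bool" where "\<And>u v. u \<noteq> v \<Longrightarrow> \<not> E (f u) (f v)"
proof -
  obtain N :: "nat \<Rightarrow> nat" and W :: "nat \<Rightarrow> nat \<Rightarrow> bool \<times> bool" where N: "strict_mono N"
    and W: "\<And>c. infinite {k. \<forall>i\<in>{N k..<N (Suc k)}. c i = W k i} \<Longrightarrow> \<not> E (fst \<circ> c) (snd \<circ> c)"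
  proof (rule meager_avoiding_blocks[OF assms])
    fix N :: "nat \<Rightarrow> nat" and W :: "nat \<Rightarrow> nat \<Rightarrow> bool \<times> bool"
    assume "strict_mono N" and W: "\<And>c. infinite {k. \<forall>i\<in>{N k..<N (Suc k)}. c i = W k i} \<Longrightarrow>
      c \<notin> {c. E (fst \<circ> c) (snd \<circ> c)}"
    from this(1) show thesis
    proof (rule that)
      fix c assume "infinite {k. \<forall>i\<in>{N k..<N (Suc k)}. c i = W k i}"
      from W[OF this] show "\<not> E (fst \<circ> c) (snd \<circ> c)" by simp
    qed
  qed
  \<comment> \<open>The number of the block that contains \<open>i\<close>. Positions before
    \<open>N 0\<close> lie in no block and receive the harmless value 0.\<close>
  define blk where "blk i = (LEAST k. i < N (Suc k))" for i
  have blk: "blk i = k" if "i \<in> {N k..<N (Suc k)}" for i k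
    unfolding blk_def
  proof (rule Least_equality)
    fix l assume "i < N (Suc l)"
    then have "N k < N (Suc l)" using that by auto
    then show "k \<le> l" using N by (simp add: strict_mono_less)
  qed (use that in auto)
  define pre where "pre u l = map u [0..<l]" for u :: "nat \<Rightarrow> bool" and l
  define f where "f u i = (let s = fst (from_nat (blk i) :: bool list \<times> bool list) in
      if pre u (length s) = s then fst (W (blk i) i) else snd (W (blk i) i))" for u i
  show thesis
  proof (rule that)
    fix u v :: "nat \<Rightarrow> bool" assume "u \<noteq> v"
    then obtain l0 where l0: "u l0 \<noteq> v l0" by blast
    define code where "code l = to_nat (pre u l, pre v l)" for l
    have "inj code"
    proof (rule injI)
      fix l l' assume "code l = code l'"
      then have "length (pre u l) = length (pre u l')" by (simp add: code_def)
      then show "l = l'" by (simp add: pre_def)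
    qed
    then have "infinite (code ` {l0<..})"
      using infinite_Ioi finite_imageD inj_on_subset by blast
    moreover have "code ` {l0<..} \<subseteq> {k. \<forall>i\<in>{N k..<N (Suc k)}. (f u i, f v i) = W k i}"
    proof clarify
      fix l i assume l: "l0 < l" and i: "i \<in> {N (code l)..<N (Suc (code l))}"
      \<comment> \<open>Since \<open>l0 < l\<close>, the words include a position where
        \<open>u\<close> and \<open>v\<close> differ. The block codes the word of \<open>u\<close>
        first, so \<open>u\<close> takes the first half of the pattern and \<open>v\<close> the
        second.\<close>
      have "pre v l \<noteq> pre u l"
      proof
        assume "pre v l = pre u l"
        then have "pre v l ! l0 = pre u l ! l0" by simp
        then show False using l l0 by (simp add: pre_def)
      qed
      moreover have "fst (from_nat (blk i) :: bool list \<times> bool list) = pre u l"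
        using blk[OF i] by (simp add: code_def)
      moreover have "length (pre u l) = l" by (simp add: pre_def)
      ultimately show "(f u i, f v i) = W (code l) i"
        using blk[OF i] by (simp add: f_def Let_def)
    qed
    ultimately have "infinite {k. \<forall>i\<in>{N k..<N (Suc k)}. (f u i, f v i) = W k i}"
      using finite_subset by blast
    from W[OF this] show "\<not> E (f u) (f v)" by (simp add: comp_def)
  qed
qed

text \<open>The relation agrees with an open \<open>U\<close> up to a meager set. If
  \<open>U\<close> contained a cylinder, then, since no pair and its bit flip are both related, the
  cylinder would be covered by a meager set and its image under the flip, against Baire's
  theorem.\<close>

lemma meager_if_bit_flip_inequivalent:
  fixes E :: "(nat \<Rightarrow> bool) \<Rightarrow> (nat \<Rightarrow> bool) \<Rightarrow> bool"
  assumes BP: "has_BP_in seq_topology {c. E (fst \<circ> c) (snd \<circ> c)}"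
    and E: "\<And>a b c. E a b \<Longrightarrow> E a c \<Longrightarrow> E b c"
    and flip: "\<And>a n. \<not> E a (a(n := \<not> a n))"
  shows "meager_in seq_topology {c. E (fst \<circ> c) (snd \<circ> c)}"
proof -
  let ?E = "{c. E (fst \<circ> c) (snd \<circ> c)}"
  obtain U where U: "openin seq_topology U" "meager_in seq_topology (sym_diff ?E U)"
    using BP unfolding has_BP_in_def by blast
  have "U = {}"
  proof (rule ccontr)
    assume "U \<noteq> {}"
    then obtain c n where c: "cylinder n c \<subseteq> U"
      using U(1) unfolding openin_seq_topology by blast
    \<comment> \<open>Position \<open>n\<close> is the first one the cylinder leaves free, so the
      flip maps the cylinder to itself.\<close>
    define \<phi> where "\<phi> = (\<lambda>d :: nat \<Rightarrow> bool \<times> bool. d(n := (fst (d n), \<not> snd (d n))))"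
    have inv: "\<phi> (\<phi> d) = d" for d by (auto simp: \<phi>_def)
    have cyl: "\<phi> d' \<in> cylinder m (\<phi> d)" if "d' \<in> cylinder m d" for m d d'
      using that by (auto simp: cylinder_def \<phi>_def)
    have cyl_n: "\<phi> d \<in> cylinder n c" if "d \<in> cylinder n c" for d
      using that by (auto simp: cylinder_def \<phi>_def)
    have cont: "continuous_map seq_topology seq_topology \<phi>"
      unfolding continuous_map
    proof (intro conjI allI impI)
      fix V :: "(nat \<Rightarrow> bool \<times> bool) set" assume V: "openin seq_topology V"
      show "openin seq_topology {d \<in> topspace seq_topology. \<phi> d \<in> V}"
        unfolding openin_seq_topology
      proof
        fix d assume "d \<in> {d \<in> topspace seq_topology. \<phi> d \<in> V}"
        then obtain m where "cylinder m (\<phi> d) \<subseteq> V" using V unfolding openin_seq_topology by auto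
        then show "\<exists>m. cylinder m d \<subseteq> {d \<in> topspace seq_topology. \<phi> d \<in> V}"
          using cyl by (intro exI[of _ m]) auto
      qed
    qed auto
    then have "homeomorphic_map seq_topology seq_topology \<phi>"
      using inv by (intro homeomorphic_maps_imp_map[of _ _ _ \<phi>]) (auto simp: homeomorphic_maps_def)
    then have "meager_in seq_topology (sym_diff ?E U \<union> \<phi> ` sym_diff ?E U)"
      by (intro meager_in_Un[OF U(2)] homeomorphic_map_meager_in[OF _ U(2)])
    moreover have "cylinder n c \<subseteq> sym_diff ?E U \<union> \<phi> ` sym_diff ?E U"
    proof
      fix d assume d: "d \<in> cylinder n c"
      have "\<not> (d \<in> ?E \<and> \<phi> d \<in> ?E)"
      proof
        assume *: "d \<in> ?E \<and> \<phi> d \<in> ?E"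
        have "fst \<circ> \<phi> d = fst \<circ> d" "snd \<circ> \<phi> d = (snd \<circ> d)(n := \<not> (snd \<circ> d) n)"
          by (auto simp: \<phi>_def fun_eq_iff)
        then show False using * E flip by (metis mem_Collect_eq)
      qed
      moreover have "d \<in> U" "\<phi> d \<in> U" using d cyl_n c by auto
      ultimately have "d \<in> sym_diff ?E U \<or> \<phi> d \<in> sym_diff ?E U" by blast
      then show "d \<in> sym_diff ?E U \<union> \<phi> ` sym_diff ?E U"
      proof
        assume "\<phi> d \<in> sym_diff ?E U"
        from imageI[OF this, of \<phi>] show ?thesis unfolding inv by (rule UnI2)
      qed (rule UnI1)
    qed
    ultimately show False
      using Baire_not_meager_in[OF completely_metrizable_seq_topology openin_cylinder, of n c]
        cylinder_self[of c n] by blast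
  qed
  then show ?thesis using U(2) by simp
qed

text \<open>The pointclass only knows real carriers, so both spaces are replaced by real copies.\<close>

lemma has_BP_in_continuous_preimage:
  assumes nice: "nice_pointclass \<P>" and BP: "pointclass_has_BP \<P>"
    and A: "in_pointclass \<P> Y A" and T: "Polish_space T" and f: "continuous_map T Y f"
  shows "has_BP_in T {t \<in> topspace T. f t \<in> A}"
proof -
  obtain Z h where Z: "Polish_space Z" "homeomorphic_map Y Z h" "h ` A \<in> \<P> Z" "A \<subseteq> topspace Y"
    using A unfolding in_pointclass_def by blast
  obtain S k where S: "Polish_space (S :: real topology)" "homeomorphic_map T S k"
    using Polish_space_has_real_copy[OF T] .
  obtain k' where k': "homeomorphic_maps T S k k'"
    using S(2) homeomorphic_map_maps by blast
  then have kk': "\<And>t. t \<in> topspace T \<Longrightarrow> k' (k t) = t" "\<And>s. s \<in> topspace S \<Longrightarrow> k (k' s) = s"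
    "continuous_map S T k'" "continuous_map T S k"
    by (auto simp: homeomorphic_maps_def)
  have "continuous_map S Z (h \<circ> f \<circ> k')"
    using f kk'(3) homeomorphic_imp_continuous_map[OF Z(2)] by (intro continuous_map_compose)
  \<comment> \<open>The pointclass has to be pulled back, and only then the Baire property read off:
    continuous preimages need not preserve that property by itself.\<close>
  then have "{s \<in> topspace S. (h \<circ> f \<circ> k') s \<in> h ` A} \<in> \<P> S"
    using nice S(1) Z(1,3) unfolding nice_pointclass_def by blast
  then have "has_BP_in S {s \<in> topspace S. (h \<circ> f \<circ> k') s \<in> h ` A}"
    using BP S(1) unfolding pointclass_has_BP_def by blast
  moreover have "homeomorphic_map S T k'"
    using k' homeomorphic_maps_sym homeomorphic_maps_imp_map by blast
  ultimately have "has_BP_in T (k' ` {s \<in> topspace S. (h \<circ> f \<circ> k') s \<in> h ` A})"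
    using homeomorphic_map_has_BP_in by blast
  moreover have "k' ` {s \<in> topspace S. (h \<circ> f \<circ> k') s \<in> h ` A} = {t \<in> topspace T. f t \<in> A}"
  proof -
    have *: "h (f t) \<in> h ` A \<longleftrightarrow> f t \<in> A" if "t \<in> topspace T" for t
      using inj_on_image_mem_iff[OF homeomorphic_imp_injective_map[OF Z(2)] _ Z(4)]
        continuous_map_funspace[OF f] that by auto
    have "k' s \<in> topspace T" if "s \<in> topspace S" for s
      using continuous_map_funspace[OF kk'(3)] that by auto
    moreover have "k t \<in> topspace S" if "t \<in> topspace T" for t
      using continuous_map_funspace[OF kk'(4)] that by auto
    ultimately show ?thesis
      using * kk'(1,2) by (force simp: image_iff)
  qed
  ultimately show ?thesis by simp
qed

section \<open>Infinite concatenations\<close>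

text \<open>Each loop takes half of the time that remains. The starting index \<open>n\<close> is a
  parameter because the second half is the same construction with one loop fewer, starting at
  \<open>Suc n\<close>.\<close>

primrec finite_concat ::
    "(nat \<Rightarrow> real \<Rightarrow> 'a::metric_space) \<Rightarrow> 'a \<Rightarrow> nat \<Rightarrow> nat \<Rightarrow> (nat \<Rightarrow> bool) \<Rightarrow> real \<Rightarrow> 'a" where
  "finite_concat \<beta> y 0 n a = (\<lambda>_. y)"
| "finite_concat \<beta> y (Suc N) n a =
     (if a n then \<beta> n else (\<lambda>_. y)) +++ finite_concat \<beta> y N (Suc n) a"

definition infinite_concat ::
    "(nat \<Rightarrow> real \<Rightarrow> 'a::metric_space) \<Rightarrow> 'a \<Rightarrow> nat \<Rightarrow> (nat \<Rightarrow> bool) \<Rightarrow> real \<Rightarrow> 'a" where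
  "infinite_concat \<beta> y n a = (\<lambda>t. lim (\<lambda>N. finite_concat \<beta> y N n a t))"

text \<open>Shifting a sequence does not change which points are its limits, so the recursion holds
  before any convergence is established.\<close>

lemma infinite_concat_rec:
  "infinite_concat \<beta> y n a =
     (if a n then \<beta> n else (\<lambda>_. y)) +++ infinite_concat \<beta> y (Suc n) a"
proof
  fix t
  let ?S = "finite_concat \<beta> y" and ?b = "if a n then \<beta> n else (\<lambda>_. y)"
  have "infinite_concat \<beta> y n a t = lim (\<lambda>N. ?S (Suc N) n a t)"
    unfolding infinite_concat_def lim_def using filterlim_sequentially_Suc[of "\<lambda>N. ?S N n a t"] by simp
  also have "\<dots> = (?b +++ infinite_concat \<beta> y (Suc n) a) t"
    by (cases "t \<le> 1/2") (simp_all add: joinpaths_def infinite_concat_def)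
  finally show "infinite_concat \<beta> y n a t = (?b +++ infinite_concat \<beta> y (Suc n) a) t" .
qed

lemma finite_concat_cong:
  "(\<And>k. n \<le> k \<Longrightarrow> k < n + N \<Longrightarrow> a k = b k) \<Longrightarrow> finite_concat \<beta> y N n a = finite_concat \<beta> y N n b"
proof (induction N arbitrary: n)
  case (Suc N)
  have "finite_concat \<beta> y N (Suc n) a = finite_concat \<beta> y N (Suc n) b"
    by (intro Suc.IH Suc.prems) auto
  then show ?case using Suc.prems[of n] by simp
qed auto

lemma infinite_concat_cong:
  "(\<And>k. n \<le> k \<Longrightarrow> a k = b k) \<Longrightarrow> infinite_concat \<beta> y n a = infinite_concat \<beta> y n b"
  unfolding infinite_concat_def using finite_concat_cong[of n _ a b \<beta> y] by presburger

section \<open>Convergence when the loops shrink to a point\<close>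

locale shrinking_loops =
  fixes X :: "'a::metric_space set" and y :: 'a and \<beta> :: "nat \<Rightarrow> real \<Rightarrow> 'a"
  assumes y: "y \<in> X"
    and path_in_loop: "\<And>n. path_in (X \<inter> ball y (inverse (real (Suc n)))) (\<beta> n)"
    and loop_ends: "\<And>n. pathstart (\<beta> n) = y" "\<And>n. pathfinish (\<beta> n) = y"
begin

abbreviation "B n \<equiv> X \<inter> ball y (inverse (real (Suc n)))"
abbreviation "S \<equiv> finite_concat \<beta> y"
abbreviation "P \<equiv> infinite_concat \<beta> y"
abbreviation "switch a n \<equiv> if a n then \<beta> n else (\<lambda>_. y)"

lemma B_mono: "m \<le> n \<Longrightarrow> B n \<subseteq> B m"
proof -
  assume "m \<le> n"
  then have "inverse (real (Suc n)) \<le> inverse (real (Suc m))" by (intro le_imp_inverse_le) auto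
  then have "dist y z < inverse (real (Suc m))" if "dist y z < inverse (real (Suc n))" for z
    using that by linarith
  then show ?thesis unfolding subset_iff Int_iff mem_ball by blast
qed

lemma center_in_B: "y \<in> B n" using y by simp

lemma switch: "path_in (B n) (switch a n)" "pathstart (switch a n) = y" "pathfinish (switch a n) = y"
  using path_in_loop loop_ends path_in_const[OF center_in_B] by auto

lemma switch_in_B: "t \<in> {0..1} \<Longrightarrow> switch a n t \<in> B n"
  by (rule path_in_apply[OF switch(1)])

lemma finite_concat: "path_in X (S N n a) \<and> pathstart (S N n a) = y \<and> pathfinish (S N n a) = y"
proof (induction N arbitrary: n)
  case 0
  then show ?case using path_in_const[OF y] by simp
next
  case (Suc N)
  have "path_in X (switch a n)" by (rule path_in_IntD[OF switch(1)])
  then show ?case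
    using Suc[of "Suc n"] switch(2,3)[of a n] by (simp del: if_split)
qed

lemma infinite_concat_ends: "pathstart (P n a) = y" "pathfinish (P n a) = y"
  using finite_concat by (auto simp: infinite_concat_def pathstart_def pathfinish_def)

lemma infinite_concat_in_B:
  assumes "t \<in> {0..1}" shows "P n a t \<in> B n"
proof (cases "t = 1")
  case True
  then show ?thesis using infinite_concat_ends(2)[of n a] center_in_B by (simp add: pathfinish_def)
next
  case False
  \<comment> \<open>Before time \<open>1 - (1/2)^k\<close> at most \<open>k\<close> loops have been
    started, so unfolding the recursion terminates. Only \<open>t = 1\<close> is not reached in this
    way.\<close>
  have *: "P n a t \<in> B n" if "0 \<le> t" "t \<le> 1 - (1/2)^k" for k t n
    using that
  proof (induction k arbitrary: n t)
    case 0
    then show ?case using infinite_concat_ends(1)[of n a] center_in_B by (simp add: pathstart_def)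
  next
    case (Suc k)
    show ?case
    proof (cases "t \<le> 1/2")
      case True
      then have "P n a t = switch a n (2 * t)"
        by (subst infinite_concat_rec) (simp add: joinpaths_def)
      then show ?thesis using switch_in_B[of "2 * t" a n] True Suc.prems by simp
    next
      case False
      then have "P n a t = P (Suc n) a (2 * t - 1)"
        by (subst infinite_concat_rec) (simp add: joinpaths_def)
      moreover have "P (Suc n) a (2 * t - 1) \<in> B (Suc n)"
        using Suc.prems False by (intro Suc.IH) auto
      ultimately show ?thesis using B_mono[of n "Suc n"] by auto
    qed
  qed
  have "0 < 1 - t" using False assms by simp
  then obtain k where "(1/2)^k < 1 - t"
    using real_arch_pow_inv[of "1 - t" "1/2"] by auto
  then show ?thesis using *[of t k] assms by simp
qed

text \<open>The two paths agree during the first \<open>N\<close> loops. Afterwards the finite one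
  rests at \<open>y\<close> while the infinite one stays in \<open>B (n + N)\<close>.\<close>

lemma dist_infinite_concat_finite_concat:
  "t \<in> {0..1} \<Longrightarrow> dist (P n a t) (S N n a t) \<le> inverse (real (Suc (n + N)))"
proof (induction N arbitrary: n t)
  case 0
  then show ?case using infinite_concat_in_B[of t n a] by (simp add: dist_commute)
next
  case (Suc N)
  show ?case
  proof (cases "t \<le> 1/2")
    case True
    then show ?thesis by (subst infinite_concat_rec) (simp add: joinpaths_def)
  next
    case False
    then have "dist (P n a t) (S (Suc N) n a t) = dist (P (Suc n) a (2 * t - 1)) (S N (Suc n) a (2 * t - 1))"
      by (subst infinite_concat_rec) (simp add: joinpaths_def)
    also have "\<dots> \<le> inverse (real (Suc (Suc n + N)))"
      using Suc.prems False by (intro Suc.IH) auto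
    finally show ?thesis by simp
  qed
qed

lemma path_in_infinite_concat: "path_in X (P n a)"
proof -
  have ul: "uniform_limit {0..1} (\<lambda>N. S N n a) (P n a) sequentially"
  proof (rule uniform_limitI)
    fix e :: real assume "0 < e"
    then obtain M where M: "inverse (real (Suc M)) < e" using reals_Archimedean by blast
    have "dist (S N n a t) (P n a t) < e" if "M \<le> N" "t \<in> {0..1}" for N t
    proof -
      have "inverse (real (Suc (n + N))) \<le> inverse (real (Suc M))"
        using that by (intro le_imp_inverse_le) auto
      then show ?thesis
        using dist_infinite_concat_finite_concat[OF that(2), of n a N] M
        unfolding dist_commute[of "S N n a t"] by linarith
    qed
    then show "\<forall>\<^sub>F N in sequentially. \<forall>t\<in>{0..1}. dist (S N n a t) (P n a t) < e"
      by (intro eventually_sequentiallyI[of M] ballI)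
  qed
  have "continuous_on {0..1} (S N n a)" for N
    using finite_concat[of N n a] by (simp add: path_in_def path_def)
  then have "continuous_on {0..1} (P n a)"
    by (intro uniform_limit_theorem[OF always_eventually ul]) simp_all
  moreover have "P n a t \<in> X" if "t \<in> {0..1}" for t
    using infinite_concat_in_B[OF that] by blast
  ultimately show ?thesis by (auto simp: path_in_def path_def path_image_def)
qed

text \<open>Both paths are compared with their common finite concatenation, hence the factor 2. This
  yields continuity of the map from sequences to loops.\<close>

lemma dist_infinite_concat:
  assumes "\<And>k. k < N \<Longrightarrow> a k = b k" "t \<in> {0..1}"
  shows "dist (P 0 a t) (P 0 b t) \<le> 2 * inverse (real (Suc N))"
proof -
  have "S N 0 a = S N 0 b" using assms(1) by (intro finite_concat_cong) auto
  then show ?thesis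
    using dist_infinite_concat_finite_concat[OF assms(2), of 0 a N]
      dist_infinite_concat_finite_concat[OF assms(2), of 0 b N]
      dist_triangle2[of "P 0 a t" "P 0 b t" "S N 0 a t"] by simp
qed

end

section \<open>Cardinality of the quotient in the case that is not open\<close>

context Peano_quotient
begin

lemma continuum_lepoll_quotient:
  assumes nice: "nice_pointclass \<P>" and BP: "pointclass_has_BP \<P>"
    and G: "in_pointclass \<P> (mtopology_of (loop_space X x)) (\<Union>G)"
    and y: "y \<in> X" and not_killed: "\<And>e. 0 < e \<Longrightarrow> \<not> loops_killed_at y e"
  shows "(UNIV :: nat set set) \<lesssim> carrier Q"
proof -
  have "\<exists>q. path_in (X \<inter> ball y (inverse (real (Suc n)))) q \<and> pathstart q = y \<and> pathfinish q = y
      \<and> hol q \<noteq> \<one>\<^bsub>Q\<^esub>" for n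
    using not_killed[of "inverse (real (Suc n))"] unfolding loops_killed_at_def by fastforce
  then obtain \<beta> where \<beta>: "\<And>n. path_in (X \<inter> ball y (inverse (real (Suc n)))) (\<beta> n)"
    "\<And>n. pathstart (\<beta> n) = y" "\<And>n. pathfinish (\<beta> n) = y" "\<And>n. hol (\<beta> n) \<noteq> \<one>\<^bsub>Q\<^esub>"
    by metis
  interpret shrinking_loops X y \<beta>
    by unfold_locales (use y \<beta> in auto)
  note PX = path_in_infinite_concat and P_ends = infinite_concat_ends
  have hol_P: "hol (P n a) = hol (switch a n) \<otimes>\<^bsub>Q\<^esub> hol (P (Suc n) a)" for n a
    by (subst infinite_concat_rec, rule hol_join[OF path_in_IntD[OF switch(1)] PX])
      (simp only: switch(3) P_ends(1))
  have PC: "hol (P n a) \<in> carrier Q" "hol (switch a n) \<in> carrier Q" for n a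
    using hol_closed[OF PX] hol_closed[OF path_in_IntD[OF switch(1)]] by blast+
  have flip: "hol (P 0 a) \<noteq> hol (P 0 (a(n := \<not> a n)))" for a n
  proof
    let ?b = "a(n := \<not> a n)"
    assume eq: "hol (P 0 a) = hol (P 0 ?b)"
    \<comment> \<open>The loops before position \<open>n\<close> are switched alike in both
      sequences and are cancelled on the left, one at a time.\<close>
    have eq_j: "hol (P j a) = hol (P j ?b)" if "j \<le> n" for j
      using that
    proof (induction j)
      case (Suc j)
      then have switch_eq: "switch a j = switch ?b j" by auto
      have "hol (switch a j) \<otimes>\<^bsub>Q\<^esub> hol (P (Suc j) a) = hol (P j a)" by (rule hol_P[symmetric])
      also have "\<dots> = hol (P j ?b)" using Suc.IH Suc.prems by linarith
      also have "\<dots> = hol (switch ?b j) \<otimes>\<^bsub>Q\<^esub> hol (P (Suc j) ?b)" by (rule hol_P)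
      finally show ?case unfolding switch_eq[symmetric] using Q.Units_l_cancel[unfolded Q.Units_eq, OF PC(2) PC(1) PC(1)] by blast
    qed (rule eq)
    have tail_eq: "P (Suc n) ?b = P (Suc n) a" by (rule infinite_concat_cong) simp
    have "hol (switch a n) \<otimes>\<^bsub>Q\<^esub> hol (P (Suc n) a) = hol (P n a)" by (rule hol_P[symmetric])
    also have "\<dots> = hol (P n ?b)" by (rule eq_j) simp
    also have "\<dots> = hol (switch ?b n) \<otimes>\<^bsub>Q\<^esub> hol (P (Suc n) ?b)" by (rule hol_P)
    finally have "hol (switch a n) = hol (switch ?b n)"
      unfolding tail_eq using Q.right_cancel[OF PC(1) PC(2) PC(2)] by blast
    \<comment> \<open>Exactly one of the two sequences switches the loop \<open>\<beta> n\<close>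
      on.\<close>
    then have "hol (\<beta> n) = hol (\<lambda>_. y)" by (cases "a n") simp_all
    then show False using \<beta>(4)[of n] hol_const[OF y] by simp
  qed
  define E where "E a b \<longleftrightarrow> hol (P 0 a) = hol (P 0 b)" for a b
  \<comment> \<open>This loop at \<open>x\<close> runs along the first concatenation and back along
    the second, so it is killed exactly when the two have the same image.\<close>
  define F where "F c = (tail y +++ (P 0 (fst \<circ> c) +++ reversepath (P 0 (snd \<circ> c)))) +++ reversepath (tail y)"
    for c :: "nat \<Rightarrow> bool \<times> bool"
  define f where "f c = restrict (F c) {0..1}" for c
  note a = tail[OF y]
  have F: "path_in X (F c)" "pathstart (F c) = x" "pathfinish (F c) = x" for c
    using a PX P_ends by (auto simp: F_def)
  have f_loops: "f c \<in> loops X x" for c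
    unfolding f_def by (rule restrict_in_loops(1)[OF F])
  have E_iff: "E (fst \<circ> c) (snd \<circ> c) \<longleftrightarrow> f c \<in> \<Union>G" for c
  proof -
    let ?a = "P 0 (fst \<circ> c)" and ?b = "P 0 (snd \<circ> c)"
    have "f c \<in> \<Union>G \<longleftrightarrow> hol (F c) = \<one>\<^bsub>Q\<^esub>"
      unfolding f_def hol_eq_one_iff[OF F] ..
    also have "\<dots> \<longleftrightarrow> hol (?a +++ reversepath ?b) = \<one>\<^bsub>Q\<^esub>"
      unfolding F_def using a PX P_ends by (intro hol_conjugate(2)) auto
    also have "hol (?a +++ reversepath ?b) = hol ?a \<otimes>\<^bsub>Q\<^esub> inv\<^bsub>Q\<^esub> hol ?b"
      using PX P_ends by (simp add: hol_join hol_reversepath del: mult_FactGroup)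
    also have "\<dots> = \<one>\<^bsub>Q\<^esub> \<longleftrightarrow> hol ?a = hol ?b"
      using PC(1) Q.inv_closed Q.inv_equality Q.inv_inv Q.r_inv by metis
    finally show ?thesis by (simp add: E_def)
  qed
  have cont: "continuous_map seq_topology (mtopology_of (loop_space X x)) f"
  proof -
    interpret L: Metric_space "loops X x" "mdist (loop_space X x)"
      using Metric_space_mspace_mdist[of "loop_space X x"] by simp
    have L: "mtopology_of (loop_space X x) = L.mtopology"
      by (simp add: mtopology_of_def)
    show ?thesis
      unfolding L L.continuous_map_to_metric
    proof (intro ballI allI impI)
      fix c :: "nat \<Rightarrow> bool \<times> bool" and e :: real assume "0 < e"
      then obtain N where N: "inverse (real (Suc N)) < e / 2"
        using reals_Archimedean[of "e/2"] by auto
      have mdist_le: "mdist (loop_space X x) (f c) (f c') \<le> 2 * inverse (real (Suc N))" if "c' \<in> cylinder N c" for c'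
      proof (rule mdist_loop_space_le[OF f_loops f_loops])
        fix t :: real assume t: "t \<in> {0..1}"
        have 1: "dist (P 0 (fst \<circ> c) s) (P 0 (fst \<circ> c') s) \<le> 2 * inverse (real (Suc N))"
          "dist (P 0 (snd \<circ> c) s) (P 0 (snd \<circ> c') s) \<le> 2 * inverse (real (Suc N))" if "s \<in> {0..1}" for s
          using \<open>c' \<in> cylinder N c\<close> by (intro dist_infinite_concat that; simp add: cylinder_def)+
        \<comment> \<open>Along the two tails the loops for \<open>c\<close> and \<open>c'\<close>
          coincide; elsewhere they run through concatenations compared in the previous step.\<close>
        have 2: "dist z z \<le> 2 * inverse (real (Suc N))" for z :: 'a by simp
        have "dist (F c t) (F c' t) \<le> 2 * inverse (real (Suc N))"
          using t unfolding F_def joinpaths_def reversepath_def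
          by (auto intro!: 1 2 simp del: of_nat_Suc dist_self)
        then show "dist (f c t) (f c' t) \<le> 2 * inverse (real (Suc N))" using t by (simp add: f_def)
      qed
      have "\<forall>c'\<in>cylinder N c. f c' \<in> L.mball (f c) e"
      proof
        fix c' assume "c' \<in> cylinder N c"
        from mdist_le[OF this] N have "mdist (loop_space X x) (f c) (f c') < e" by linarith
        then show "f c' \<in> L.mball (f c) e" by (simp add: f_loops)
      qed
      then show "\<exists>U. openin seq_topology U \<and> c \<in> U \<and> (\<forall>c'\<in>U. f c' \<in> L.mball (f c) e)"
        by (intro exI[of _ "cylinder N c"] conjI openin_cylinder cylinder_self)
    qed
  qed
  have "has_BP_in seq_topology {c. E (fst \<circ> c) (snd \<circ> c)}"
    using has_BP_in_continuous_preimage[OF nice BP G Polish_seq_topology cont] by (simp add: E_iff)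
  then have "meager_in seq_topology {c. E (fst \<circ> c) (snd \<circ> c)}"
  proof (rule meager_if_bit_flip_inequivalent)
    show "E b c" if "E a b" "E a c" for a b c using that by (simp add: E_def)
    show "\<not> E a (a(n := \<not> a n))" for a n unfolding E_def by (rule flip)
  qed
  then obtain g :: "(nat \<Rightarrow> bool) \<Rightarrow> nat \<Rightarrow> bool" where g: "\<And>u v. u \<noteq> v \<Longrightarrow> \<not> E (g u) (g v)"
    using Mycielski[of E] by blast
  have "inj (\<lambda>A :: nat set. hol (P 0 (g (\<lambda>n. n \<in> A))))"
  proof (rule injI)
    fix A B :: "nat set" assume "hol (P 0 (g (\<lambda>n. n \<in> A))) = hol (P 0 (g (\<lambda>n. n \<in> B)))"
    then have "(\<lambda>n. n \<in> A) = (\<lambda>n. n \<in> B)" using g unfolding E_def by blast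
    then show "A = B" by (auto simp: fun_eq_iff)
  qed
  then show ?thesis
    unfolding lepoll_def using PC(1) by blast
qed

text \<open>Every coset is the image of a loop, and the homeomorphism that witnesses membership in
  the pointclass injects the loops into the reals.\<close>

lemma quotient_lepoll_continuum:
  assumes "in_pointclass \<P> (mtopology_of (loop_space X x)) A"
  shows "carrier Q \<lesssim> (UNIV :: nat set set)"
proof -
  obtain Z :: "real topology" and h where h: "homeomorphic_map (mtopology_of (loop_space X x)) Z h"
    using assms unfolding in_pointclass_def by blast
  have "carrier Q \<lesssim> loops X x"
    unfolding hol_onto[symmetric] by (rule image_lepoll)
  also have "loops X x \<lesssim> (UNIV :: real set)"
    using homeomorphic_imp_injective_map[OF h] unfolding lepoll_def by auto
  also have "(UNIV :: real set) \<lesssim> (UNIV :: nat set set)"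
    using nat_sets_eqpoll_reals eqpoll_imp_lepoll eqpoll_sym by blast
  finally show ?thesis .
qed

end

theorem theorem3p14:
  fixes \<P> :: pointclass
    and X :: "'a::metric_space set" and x :: 'a
    and G :: "(real \<Rightarrow> 'a) set set"
  assumes "nice_pointclass \<P>" and "pointclass_has_BP \<P>"
    and "Peano_continuum X" and "x \<in> X"
    and "G \<lhd> fundamental_group X x"
    and "in_pointclass \<P> (mtopology_of (loop_space X x)) (\<Union>G)"
  shows "(openin (mtopology_of (loop_space X x)) (\<Union>G) \<longrightarrow>
            finitely_generated_group (fundamental_group X x Mod G)) \<and>
         (\<not> openin (mtopology_of (loop_space X x)) (\<Union>G) \<longrightarrow>
            carrier (fundamental_group X x Mod G) \<approx> (UNIV :: nat set set))"
proof -
  interpret Peano_quotient X x G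
    using assms by (intro Peano_quotient.intro Peano_quotient_axioms.intro)
  show ?thesis
  proof (intro conjI impI)
    assume "openin (mtopology_of (loop_space X x)) (\<Union>G)"
    then obtain e where "0 < e" "small_loops_killed e"
      using loops_killed_at_if_open small_loops_killed_if_pointwise by metis
    then show "finitely_generated_group Q"
      by (rule finitely_generated_if_small_loops_killed)
  next
    assume "\<not> openin (mtopology_of (loop_space X x)) (\<Union>G)"
    \<comment> \<open>If sufficiently small loops were killed at every point, compactness would make
      the radius uniform and \<open>\<Union>G\<close> open.\<close>
    then obtain y where "y \<in> X" "\<And>e. 0 < e \<Longrightarrow> \<not> loops_killed_at y e"
      using small_loops_killed_if_pointwise open_if_small_loops_killed by metis
    then have "(UNIV :: nat set set) \<lesssim> carrier Q"
      using continuum_lepoll_quotient assms(1,2,6) by blast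
    then show "carrier Q \<approx> (UNIV :: nat set set)"
      using quotient_lepoll_continuum[OF assms(6)] lepoll_antisym by blast
  qed
qed

end
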